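(* Let $n\ge 1$ and $y>1$. Then $$\sigma_n(y)=4\arccos\frac{1}{y^{1/(2n)}}.$$ Moreover, for each $k=0,1,\dots,2n-1$ the polynomial $$f_{n,k}(t)=(-1)^kT_n\!\left(y^{1/n}\cos\!\left(t-\frac{\pi k}{n}\right)-y^{1/n}+1\right)$$ belongs to $\mathcal{F}_n(y)$ and satisfies $\mu(f_{n,k})=\sigma_n(y)$; and these $2n$ polynomials are the only elements $f\in\mathcal{F}_n(y)$ with $\mu(f)=\sigma_n(y)$.
   Context: $\mathcal{F}_n$ denotes the set of real trigonometric polynomials $f(t)=\frac{a_0}{2}+\sum_{k=1}^n(a_k\cos kt+b_k\sin kt)$ of order at most $n$ with real coefficients ($\mathcal{F}_{n-1}$ likewise for order $\le n-1$). $\mathbb{T}$ is the torus $[0,2\pi)$ with endpoints identified, with Lebesgue measure $\mathrm{mes}$. For $f\in\mathcal{F}_n$, $\mu(f)=\mathrm{mes}\{t\in\mathbb{T}:|f(t)|\ge 1\}$. For $y\ge 0$, $\mathcal{F}_n(y)=\{y\cos nt+f_{n-1}(t): f_{n-1}\in\mathcal{F}_{n-1}\}$ and $\sigma_n(y)=\inf\{\mu(f):f\in\mathcal{F}_n(y)\}$. $T_n$ is the Chebyshev polynomial of the first kind, $T_n(x)=\cos(n\arccos x)$ for $x\in[-1,1]$. *)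

theory Defs
  imports "HOL-Analysis.Analysis"
begin

fun cheb_T :: "nat \<Rightarrow> real \<Rightarrow> real" where
  "cheb_T 0 x = 1"
| "cheb_T (Suc 0) x = x"
| "cheb_T (Suc (Suc n)) x = 2 * x * cheb_T (Suc n) x - cheb_T n x"

definition trig_poly :: "nat \<Rightarrow> (real \<Rightarrow> real) \<Rightarrow> bool" where
  "trig_poly m f \<longleftrightarrow> (\<exists>a b :: nat \<Rightarrow> real. \<forall>t.
      f t = a 0 / 2 + (\<Sum>k=1..m. a k * cos (real k * t) + b k * sin (real k * t)))"

definition mu :: "(real \<Rightarrow> real) \<Rightarrow> real" where
  "mu f = measure lborel {t \<in> {0..<2*pi}. \<bar>f t\<bar> \<ge> 1}"

definition Fny :: "nat \<Rightarrow> real \<Rightarrow> (real \<Rightarrow> real) set" where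
  "Fny n y = {f. \<exists>g. trig_poly (n - 1) g \<and> f = (\<lambda>t. y * cos (real n * t) + g t)}"

definition sigma :: "nat \<Rightarrow> real \<Rightarrow> real" where
  "sigma n y = Inf (mu ` Fny n y)"

definition f_nk :: "nat \<Rightarrow> real \<Rightarrow> nat \<Rightarrow> real \<Rightarrow> real" where
  "f_nk n y k t = (-1) ^ k * cheb_T n (y powr (1 / real n) * cos (t - pi * real k / real n)
                     - y powr (1 / real n) + 1)"

end

theory Submission
  imports Defs "HOL-Complex_Analysis.Complex_Analysis"
begin

text \<open>
  On the unit circle \<open>f\<close> is the boundary value of \<open>F z = p z / z ^ n\<close>, where \<open>p\<close> is a self-reciprocal
  polynomial of degree \<open>2 * n\<close> with \<open>p 0 = y / 2\<close>. Let \<open>E = {t. \<bar>f t\<bar> \<le> 1}\<close>, let \<open>H\<close> be the Herglotz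
  integral of the indicator function of \<open>E\<close>, and \<open>x = exp (\<i> * pi * H / 2)\<close>, which maps the complement
  of \<open>E\<close> on the sphere into the right half-plane. With \<open>q = x 0 = cis (\<bar>E\<bar> / 4)\<close>, the product
  \<open>B = (x - q) (x - cnj q) / ((x + q) (x + cnj q))\<close> is bounded by one off \<open>E\<close> and vanishes at \<open>0\<close> and at
  infinity. Let \<open>k z / z ^ n\<close> be the preimage of \<open>F\<close> under \<open>w \<mapsto> (w + 1 / w) / 2\<close> of modulus at least
  one; its modulus tends to one where \<open>F\<close> approaches \<open>[-1, 1]\<close>. The maximum principle gives
  \<open>\<bar>k B\<^sup>n / z\<^sup>n\<bar> \<le> 1\<close> on the sphere. The function \<open>A = ((x - cnj q) / (x + q))\<^sup>2\<close> has the same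
  modulus as \<open>B\<close> on the circle off \<open>E\<close>, so the maximum principle on the disc gives \<open>\<bar>k A\<^sup>n\<bar> \<le> 1\<close>,
  which at \<open>0\<close> reads \<open>y * sin (\<bar>E\<bar> / 4) ^ (2 * n) \<le> 1\<close>.

  In the case of equality both functions are constant. Hence \<open>x\<^sup>2\<close> is a Moebius function of \<open>z\<close>, so \<open>E\<close> is
  an arc, and \<open>F = (B\<^sup>n + 1 / B\<^sup>n) / 2\<close> up to sign, which is the Chebyshev polynomial of an
  affine function of the cosine.
\<close>

section \<open>A maximum principle and the inverse Joukowski map\<close>

text \<open>The set \<open>K\<close> of points of \<open>U\<close> where the modulus is at least
  \<open>c\<close> is compact, so the ordinary principle applies to \<open>K\<close>. The boundary
  condition constrains only the modulus near the boundary, since the branches used later jump across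
  the preimage of the segment [-1, 1].\<close>

lemma maximum_modulus_unbounded:
  fixes g :: "complex \<Rightarrow> complex"
  assumes U: "open U" and hol: "g holomorphic_on U"
    and bdry: "\<And>w. w \<in> closure U \<Longrightarrow> w \<notin> U \<Longrightarrow> eventually (\<lambda>z. norm (g z) < c) (at w within U)"
    and inf: "\<And>z. z \<in> U \<Longrightarrow> norm z > R \<Longrightarrow> norm (g z) < c"
    and z: "z \<in> U"
  shows "norm (g z) \<le> c"
proof (rule ccontr)
  assume "\<not> norm (g z) \<le> c"
  define K where "K = {z\<in>U. c \<le> norm (g z)}"
  have zK: "z \<in> K" using z \<open>\<not> _\<close> by (auto simp: K_def)
  have cont: "continuous_on U g" by (rule holomorphic_on_imp_continuous_on[OF hol])
  have "w \<in> K" if w: "w \<in> closure K" for w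
  proof -
    have wU: "w \<in> closure U" using w closure_mono[of K U] by (auto simp: K_def)
    show ?thesis
    \<comment> \<open>A limit of points of \<open>K\<close> cannot lie on the boundary of
      \<open>U\<close>, where the modulus is eventually below \<open>c\<close>; inside
      \<open>U\<close>, continuity puts it into \<open>K\<close>.\<close>
    proof (cases "w \<in> U")
      case False
      then have "w islimpt K" using w by (auto simp: closure_def K_def)
      then have "frequently (\<lambda>z. z \<in> K) (at w)" by (simp add: islimpt_conv_frequently_at)
      moreover have "eventually (\<lambda>z. z \<in> U \<longrightarrow> norm (g z) < c) (at w)"
        using bdry[OF wU False] unfolding eventually_at_filter by (rule eventually_mono) blast
      ultimately have "frequently (\<lambda>z. z \<in> K \<and> (z \<in> U \<longrightarrow> norm (g z) < c)) (at w)"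
        by (rule frequently_eventually_frequently)
      then show ?thesis by (auto simp: K_def dest!: frequently_ex)
    next
      case True
      then have co: "isCont g w" using cont U by (simp add: continuous_on_eq_continuous_at)
      show ?thesis
      proof (rule ccontr)
        assume "w \<notin> K"
        then have "norm (g w) < c" using True by (auto simp: K_def)
        then have "eventually (\<lambda>z. norm (g z) < c) (at w)"
          using order_tendstoD(2)[OF tendsto_norm[OF co[unfolded isCont_def]]] by blast
        moreover have "w islimpt K" using w \<open>w \<notin> K\<close> by (auto simp: closure_def)
        then have "frequently (\<lambda>z. z \<in> K) (at w)" by (simp add: islimpt_conv_frequently_at)
        ultimately have "frequently (\<lambda>z. z \<in> K \<and> norm (g z) < c) (at w)"
          by (intro frequently_eventually_frequently)
        then show False by (auto simp: K_def dest!: frequently_ex)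
      qed
    qed
  qed
  then have "closed K" by (simp add: closure_subset_eq[symmetric] subsetI)
  moreover have "K \<subseteq> cball 0 R" using inf by (force simp: K_def)
  then have bK: "bounded K" using bounded_cball bounded_subset by blast
  ultimately have clK: "closure K = K" by simp
  have "norm (g z) \<le> c"
  proof (rule maximum_modulus_frontier[of g K])
    show "g holomorphic_on interior K"
      using interior_subset[of K] by (intro holomorphic_on_subset[OF hol]) (auto simp: K_def)
    show "continuous_on (closure K) g"
      unfolding clK using cont by (rule continuous_on_subset) (auto simp: K_def)
    show "bounded K" by fact
    show "z \<in> K" by fact
    fix w assume "w \<in> frontier K"
    then have wK: "w \<in> K" "w \<notin> interior K" by (auto simp: frontier_def clK)
    \<comment> \<open>Points with modulus above \<open>c\<close> are interior to \<open>K\<close>,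
      so on the frontier the modulus is at most \<open>c\<close>.\<close>
    have "open (U \<inter> (\<lambda>z. norm (g z)) -` {c<..})"
      using cont U by (intro continuous_open_preimage continuous_on_norm) auto
    then have "U \<inter> (\<lambda>z. norm (g z)) -` {c<..} \<subseteq> interior K"
      by (intro interior_maximal) (auto simp: K_def)
    then show "norm (g w) \<le> c" using wK by (force simp: K_def)
  qed
  with \<open>\<not> _\<close> show False by simp
qed

text \<open>The modulus of the root \<open>w\<close> of \<open>w + 1 / w = 2 * v\<close> with
  \<open>norm w \<ge> 1\<close>. Here \<open>s\<close> is the semi-major axis of the ellipse through
  \<open>v\<close> with foci -1 and 1. In this form continuity on the whole plane is evident,
  whereas the root itself jumps across [-1, 1].\<close>

definition joukowski_modulus :: "complex \<Rightarrow> real" where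
  "joukowski_modulus v =
     (let s = (norm (v - 1) + norm (v + 1)) / 2 in s + sqrt (s\<^sup>2 - 1))"

lemma joukowski_modulus_sum_ge: "(norm (v - 1) + norm (v + 1)) / 2 \<ge> (1::real)" for v :: complex
  using norm_triangle_ineq4[of "v + 1" "v - 1"] by simp

lemma joukowski_modulus_ge_1: "joukowski_modulus v \<ge> 1"
  using joukowski_modulus_sum_ge[of v] by (auto simp: joukowski_modulus_def Let_def intro!: add_increasing2)

lemma continuous_joukowski_modulus: "continuous_on S joukowski_modulus"
  unfolding joukowski_modulus_def Let_def by (intro continuous_intros) auto

lemma joukowski_modulus_cnj [simp]: "joukowski_modulus (cnj v) = joukowski_modulus v"
  unfolding joukowski_modulus_def
  by (metis complex_cnj_add complex_cnj_diff complex_cnj_one complex_mod_cnj)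

text \<open>With \<open>r\<close> a square root of \<open>w\<close>, the numbers
  \<open>v + 1\<close> and \<open>v - 1\<close> are half the squares of \<open>r + 1 / r\<close> and
  \<open>r - 1 / r\<close>. The parallelogram law then evaluates the sum of the focal
  distances.\<close>

lemma joukowski_modulus_eqI:
  assumes w: "w + 1 / w = 2 * v" "norm w \<ge> 1"
  shows "joukowski_modulus v = norm w"
proof -
  define r where "r = csqrt w"
  have w0: "w \<noteq> 0" and r2: "w = r\<^sup>2" using w by (auto simp: r_def)
  then have r0: "r \<noteq> 0" by auto
  have v: "v = (r\<^sup>2 + 1 / r\<^sup>2) / 2" using w(1) by (simp add: r2)
  have p: "v + 1 = (r + 1 / r)\<^sup>2 / 2" "v - 1 = (r - 1 / r)\<^sup>2 / 2"
    unfolding v using r0 by (simp_all add: power2_eq_square divide_simps) (simp_all add: algebra_simps)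
  have par: "(norm (r - 1 / r))\<^sup>2 + (norm (r + 1 / r))\<^sup>2 = 2 * ((norm r)\<^sup>2 + (norm (1 / r))\<^sup>2)"
    unfolding cmod_power2 by (simp only: plus_complex.sel minus_complex.sel) algebra
  have "norm (v - 1) + norm (v + 1) = ((norm (r - 1 / r))\<^sup>2 + (norm (r + 1 / r))\<^sup>2) / 2"
    by (simp only: p norm_power norm_divide) (simp add: add_divide_distrib)
  also have "\<dots> = norm w + 1 / norm w"
    using par by (simp add: r2 norm_power norm_divide power_divide)
  finally have s: "(norm (v - 1) + norm (v + 1)) / 2 = (norm w + 1 / norm w) / 2" by simp
  have "((norm w + 1 / norm w) / 2)\<^sup>2 - 1 = ((norm w - 1 / norm w) / 2)\<^sup>2"
    using w0 by (simp add: field_simps power2_eq_square)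
  moreover have "norm w - 1 / norm w \<ge> 0" using w(2) by (smt (verit) divide_le_eq_1)
  ultimately show ?thesis
    unfolding joukowski_modulus_def s Let_def
    by (simp only: real_sqrt_abs abs_of_nonneg) (simp add: add_divide_distrib diff_divide_distrib)
qed

text \<open>With \<open>v\<close> factored out, the principal square root meets its cut, for nonzero
  \<open>v\<close>, exactly on [-1, 1]. The factor \<open>v\<close> later absorbs a power of
  \<open>z\<close> and removes a pole at the origin.\<close>

definition joukowski_inv :: "complex \<Rightarrow> complex" where
  "joukowski_inv v = v * (1 + csqrt (1 - 1 / v\<^sup>2))"

lemma joukowski_inv_sum:
  assumes "v \<noteq> 0"
  shows "joukowski_inv v + 1 / joukowski_inv v = 2 * v"
proof -
  define s where "s = csqrt (1 - 1 / v\<^sup>2)"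
  have s2: "s\<^sup>2 = 1 - 1 / v\<^sup>2" by (simp add: s_def)
  have "(1 + s) * (1 - s) = 1 / v\<^sup>2" using s2 by (simp add: algebra_simps power2_eq_square)
  then have a: "(v * (1 + s)) * (v * (1 - s)) = 1"
    using assms by (simp add: power2_eq_square mult_ac)
  then have b: "1 / (v * (1 + s)) = v * (1 - s)" by (metis mult_zero_left nonzero_eq_divide_eq mult.commute zero_neq_one)
  show "joukowski_inv v + 1 / joukowski_inv v = 2 * v"
    unfolding joukowski_inv_def s_def[symmetric] b by (simp add: algebra_simps)
qed

lemma norm_joukowski_inv:
  assumes "v \<noteq> 0"
  shows "norm (joukowski_inv v) = joukowski_modulus v"
proof (rule joukowski_modulus_eqI[symmetric])
  show "joukowski_inv v + 1 / joukowski_inv v = 2 * v" using assms by (rule joukowski_inv_sum)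
  define s where "s = csqrt (1 - 1 / v\<^sup>2)"
  have s2: "s\<^sup>2 = 1 - 1 / v\<^sup>2" by (simp add: s_def)
  have "(1 + s) * (1 - s) = 1 / v\<^sup>2" using s2 by (simp add: algebra_simps power2_eq_square)
  then have a: "(v * (1 + s)) * (v * (1 - s)) = 1"
    using assms by (simp add: power2_eq_square mult_ac)
  \<comment> \<open>The two roots \<open>v * (1 + s)\<close> and \<open>v * (1 - s)\<close> have
    product 1; the principal branch makes the first one the larger in modulus.\<close>
  have "Re s \<ge> 0" using csqrt_principal[of "1 - 1 / v\<^sup>2"] by (auto simp: s_def)
  then have "norm (1 - s) \<le> norm (1 + s)"
    unfolding cmod_def by (intro real_sqrt_le_mono) (simp add: power2_eq_square algebra_simps)
  then have "norm (v * (1 - s)) \<le> norm (v * (1 + s))" by (simp add: norm_mult mult_left_mono)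
  moreover have "norm (v * (1 + s)) * norm (v * (1 - s)) = 1" by (metis a norm_mult norm_one)
  ultimately have "1 \<le> norm (v * (1 + s)) * norm (v * (1 + s))" by (metis mult_left_mono norm_ge_zero)
  then have "1\<^sup>2 \<le> (norm (v * (1 + s)))\<^sup>2" by (simp add: power2_eq_square)
  then have "1 \<le> norm (v * (1 + s))" by (rule power2_le_imp_le) simp
  then show "norm (joukowski_inv v) \<ge> 1" by (simp only: joukowski_inv_def s_def)
qed

text \<open>The hypothesis describes the segment [-1, 1], where the ellipse degenerates and the
  focal distances add up to 2.\<close>

lemma joukowski_modulus_eq_1:
  assumes "v = 0 \<or> 1 - 1 / v\<^sup>2 \<in> \<real>\<^sub>\<le>\<^sub>0"
  shows "joukowski_modulus v = 1"
proof -
  have "\<exists>u. v = complex_of_real u \<and> \<bar>u\<bar> \<le> 1"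
  proof (cases "v = 0")
    case False
    with assms obtain r where r: "r \<le> 0" "1 - 1 / v\<^sup>2 = complex_of_real r"
      by (auto elim!: nonpos_Reals_cases)
    then have c: "1 / v\<^sup>2 = complex_of_real (1 - r)" by (simp add: algebra_simps)
    have "v\<^sup>2 = 1 / (1 / v\<^sup>2)" by simp
    then have v2: "v\<^sup>2 = complex_of_real (1 / (1 - r))" unfolding c by simp
    define u where "u = sqrt (1 / (1 - r))"
    have "v\<^sup>2 = (complex_of_real u)\<^sup>2" using r(1) v2 by (simp add: u_def flip: of_real_power)
    then have "v = of_real u \<or> v = of_real (- u)" by (simp add: power2_eq_iff)
    moreover have "\<bar>u\<bar> \<le> 1" using r(1) by (simp add: u_def)
    ultimately show ?thesis by (metis abs_minus_cancel)
  qed (auto intro!: exI[of _ 0])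
  then obtain u where u: "v = complex_of_real u" "\<bar>u\<bar> \<le> 1" by blast
  have "v - 1 = of_real (u - 1)" "v + 1 = of_real (u + 1)" by (simp_all add: u)
  then have "norm (v - 1) = 1 - u" "norm (v + 1) = 1 + u"
    using u(2) by (simp_all only: norm_of_real)
  then show ?thesis by (simp add: joukowski_modulus_def)
qed

section \<open>The Herglotz transform of a set of angles\<close>

text \<open>In the disc the real part is the Poisson integral of the indicator function of
  \<open>E\<close>, that is, the harmonic measure of the corresponding part of the circle.\<close>

definition herglotz :: "real set \<Rightarrow> complex \<Rightarrow> complex" where
  "herglotz E z = (LINT t:E|lborel. (cis t + z) / (cis t - z)) / of_real (2 * pi)"

lemma set_integrable_compact:
  fixes g :: "real \<Rightarrow> 'a :: {banach, second_countable_topology}"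
  assumes "compact E" "continuous_on E g"
  shows "set_integrable lborel E g"
  unfolding set_integrable_def using assms by (rule borel_integrable_compact)

lemma norm_set_integral_compact_le:
  fixes g :: "real \<Rightarrow> 'a :: {banach, second_countable_topology}"
  assumes E: "compact E" and g: "continuous_on E g" and M: "\<And>t. t \<in> E \<Longrightarrow> norm (g t) \<le> M"
  shows "norm (LINT t:E|lborel. g t) \<le> M * measure lborel E"
proof -
  have "norm (LINT t:E|lborel. g t) \<le> (LINT t:E|lborel. norm (g t))"
    by (rule set_integral_norm_bound[OF set_integrable_compact[OF E g]])
  also have "\<dots> \<le> (LINT t:E|lborel. M)"
    using E g M by (intro set_integral_mono set_integrable_compact continuous_intros) auto
  also have "\<dots> = M * measure lborel E"
    using E by (simp add: set_lebesgue_integral_def mult.commute)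
  finally show ?thesis .
qed

text \<open>The right-hand side is the Poisson kernel, whose sign in the disc is evident.\<close>

lemma Re_herglotz_kernel:
  assumes "norm c = 1" "c \<noteq> z"
  shows "Re ((c + z) / (c - z)) = (1 - (norm z)\<^sup>2) / (norm (c - z))\<^sup>2"
proof -
  have "(c + z) / (c - z) = (c + z) * cnj (c - z) / of_real ((norm (c - z))\<^sup>2)"
    by (subst complex_div_cnj) simp
  moreover have "Re ((c + z) * cnj (c - z)) = (norm c)\<^sup>2 - (norm z)\<^sup>2"
    unfolding cmod_power2 by (simp add: power2_eq_square algebra_simps)
  ultimately show ?thesis using assms by (simp add: Re_divide_of_real)
qed

text \<open>The total mass of the kernel comes from Cauchy's formula for the constant function 1. It
  gives the upper bound for the integral over a subset.\<close>

lemma herglotz_kernel_integral_full: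
  assumes "norm z < 1"
  shows "(LINT t:{0..2*pi}|lborel. (cis t + z) / (cis t - z)) = of_real (2 * pi)"
proof -
  have ne: "cis t \<noteq> z" for t using assms by auto
  have "((\<lambda>u. 1 / (u - z)) has_contour_integral (2 * of_real pi * \<i> * 1)) (circlepath 0 1)"
    using assms by (intro Cauchy_integral_circlepath_simple) auto
  then have "((\<lambda>t. 1 / (cis t - z) * \<i> * cis t) has_integral (2 * of_real pi * \<i>)) {0..2*pi}"
    unfolding circlepath_def by (subst (asm) has_contour_integral_part_circlepath_iff) auto
  \<comment> \<open>The kernel equals \<open>2 * cis t / (cis t - z) - 1\<close>, so the Cauchy
    integrand is rescaled and 1 is subtracted.\<close>
  then have "((\<lambda>t. (2 / \<i>) * (1 / (cis t - z) * \<i> * cis t) - 1) has_integral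
      ((2 / \<i>) * (2 * of_real pi * \<i>) - (2 * pi - 0) *\<^sub>R 1)) {0..2*pi}"
    by (intro has_integral_diff has_integral_mult_right) (use has_integral_const_real[of "1::complex" 0 "2*pi"] in auto)
  moreover have "(2 / \<i>) * (1 / (cis t - z) * \<i> * cis t) - 1 = (cis t + z) / (cis t - z)" for t
    using ne[of t] by (simp add: divide_simps)
  moreover have "(2 / \<i>) * (2 * of_real pi * \<i>) - (2 * pi - 0) *\<^sub>R 1 = complex_of_real (2 * pi)"
    by (simp add: scaleR_conv_of_real)
  ultimately have *: "((\<lambda>t. (cis t + z) / (cis t - z)) has_integral of_real (2 * pi)) {0..2*pi}"
    by (simp only:)
  have "set_integrable lborel {0..2*pi} (\<lambda>t. (cis t + z) / (cis t - z))"
    using ne by (intro set_integrable_compact continuous_intros) auto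
  from set_borel_integral_eq_integral(2)[OF this] * show ?thesis by (simp add: integral_unique)
qed

lemma inversion_circle:
  assumes "norm z = 1"
  shows "1 / cnj z = z"
proof -
  have "z * cnj z = 1" using complex_norm_square[of z] assms by simp
  then show ?thesis using assms by (auto simp: divide_eq_eq)
qed

locale circle_set =
  fixes E :: "real set"
  assumes compact_E: "compact E" and E_subset: "E \<subseteq> {0..2*pi}"
begin

lemma closed_cis_E: "closed (cis ` E)"
  by (intro compact_imp_closed compact_continuous_image continuous_intros compact_E)

lemma continuous_kernel: "z \<notin> cis ` E \<Longrightarrow> continuous_on E (\<lambda>t. (cis t + z) / (cis t - z))"
  by (intro continuous_intros) auto

text \<open>Differentiation under the integral sign by a direct estimate: the difference quotient
  differs from the integral of the differentiated kernel by at most a multiple of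
  \<open>norm (z - w)\<close>.\<close>

lemma herglotz_holomorphic: "herglotz E holomorphic_on - cis ` E"
proof -
  define I where "I = (\<lambda>z. LINT t:E|lborel. (cis t + z) / (cis t - z))"
  have "\<exists>D. (I has_field_derivative D) (at w)" if w: "w \<notin> cis ` E" for w
  proof -
    obtain d where d: "d > 0" "\<And>t. t \<in> E \<Longrightarrow> d \<le> norm (cis t - w)"
      using separate_point_closed[OF closed_cis_E w] by (auto simp: dist_norm norm_minus_commute)
    have alg: "k / (A * B) - k / B\<^sup>2 = k * (B - A) / (A * B\<^sup>2)"
      if "A \<noteq> 0" "B \<noteq> 0" "z - w \<noteq> 0" for A B k z :: complex
      using that by (simp add: field_simps power2_eq_square)
    define D where "D = (LINT t:E|lborel. 2 * cis t / (cis t - w)\<^sup>2)"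
    \<comment> \<open>The constant comes from \<open>d \<le> norm (cis t - w)\<close> and, for
      \<open>z\<close> within \<open>d / 2\<close> of \<open>w\<close>, from
      \<open>d / 2 \<le> norm (cis t - z)\<close>.\<close>
    define C where "C = 2 / (d / 2 * d\<^sup>2) * measure lborel E"
    have bound: "norm ((I z - I w) / (z - w) - D) \<le> C * norm (z - w)" if z: "norm (z - w) < d / 2" "z \<noteq> w" for z
    proof -
      have dz: "d / 2 \<le> norm (cis t - z)" if "t \<in> E" for t
        using d(2)[OF that] z norm_triangle_ineq[of "cis t - z" "z - w"] by simp
      have zE: "z \<notin> cis ` E" using dz d(1) by force
      have i: "set_integrable lborel E (\<lambda>t. (cis t + z) / (cis t - z))"
        "set_integrable lborel E (\<lambda>t. (cis t + w) / (cis t - w))"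
        by (intro set_integrable_compact compact_E continuous_kernel zE w)+
      have i2: "set_integrable lborel E (\<lambda>t. 2 * cis t / (cis t - w)\<^sup>2)"
        using w by (intro set_integrable_compact compact_E continuous_intros) auto
      have "(I z - I w) / (z - w) - D =
          (LINT t:E|lborel. ((cis t + z) / (cis t - z) - (cis t + w) / (cis t - w)) / (z - w) - 2 * cis t / (cis t - w)\<^sup>2)"
        unfolding I_def D_def using i i2 by (simp add: set_integral_diff)
      also have "\<dots> = (LINT t:E|lborel. 2 * cis t * (z - w) / ((cis t - z) * (cis t - w)\<^sup>2))"
      proof (rule set_lebesgue_integral_cong)
        show "\<forall>t. t \<in> E \<longrightarrow> ((cis t + z) / (cis t - z) - (cis t + w) / (cis t - w)) / (z - w) - 2 * cis t / (cis t - w)\<^sup>2 =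
          2 * cis t * (z - w) / ((cis t - z) * (cis t - w)\<^sup>2)"
        proof safe
          fix t assume t: "t \<in> E"
          have nz: "cis t - z \<noteq> 0" "cis t - w \<noteq> 0" "z - w \<noteq> 0"
            using zE w t z(2) by auto
          have "(cis t + z) / (cis t - z) - (cis t + w) / (cis t - w) = 2 * cis t * (z - w) / ((cis t - z) * (cis t - w))"
            using nz by (simp add: diff_frac_eq) (simp add: algebra_simps)
          then have "((cis t + z) / (cis t - z) - (cis t + w) / (cis t - w)) / (z - w) - 2 * cis t / (cis t - w)\<^sup>2
            = 2 * cis t / ((cis t - z) * (cis t - w)) - 2 * cis t / (cis t - w)\<^sup>2"
            using nz by simp
          also have "\<dots> = 2 * cis t * ((cis t - w) - (cis t - z)) / ((cis t - z) * (cis t - w)\<^sup>2)"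
            using nz by (rule alg)
          finally show "((cis t + z) / (cis t - z) - (cis t + w) / (cis t - w)) / (z - w) - 2 * cis t / (cis t - w)\<^sup>2 =
            2 * cis t * (z - w) / ((cis t - z) * (cis t - w)\<^sup>2)" by simp
        qed
      qed (use borel_compact[OF compact_E] in simp)
      also have "norm \<dots> \<le> 2 * norm (z - w) / (d / 2 * d\<^sup>2) * measure lborel E"
      proof (rule norm_set_integral_compact_le[OF compact_E])
        show "continuous_on E (\<lambda>t. 2 * cis t * (z - w) / ((cis t - z) * (cis t - w)\<^sup>2))"
          using zE w by (intro continuous_intros) auto
        fix t assume t: "t \<in> E"
        have lb: "d / 2 * d\<^sup>2 \<le> norm (cis t - z) * (norm (cis t - w))\<^sup>2"
          using dz[OF t] d(2)[OF t] d(1) by (intro mult_mono power_mono) auto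
        have "2 * norm (z - w) / (norm (cis t - z) * (norm (cis t - w))\<^sup>2) \<le> 2 * norm (z - w) / (d / 2 * d\<^sup>2)"
          by (rule divide_left_mono[OF lb _ mult_pos_pos[OF less_le_trans[OF _ lb]]]) (use d(1) in auto)
        then show "norm (2 * cis t * (z - w) / ((cis t - z) * (cis t - w)\<^sup>2)) \<le> 2 * norm (z - w) / (d / 2 * d\<^sup>2)"
          by (simp add: norm_mult norm_divide norm_power)
      qed
      also have "\<dots> = C * norm (z - w)" by (simp add: C_def)
      finally show ?thesis .
    qed
    have "((\<lambda>z. (I z - I w) / (z - w) - D) \<longlongrightarrow> 0) (at w)"
    proof (rule Lim_null_comparison)
      show "eventually (\<lambda>z. norm ((I z - I w) / (z - w) - D) \<le> C * norm (z - w)) (at w)"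
        unfolding eventually_at using d(1) bound by (auto simp: dist_norm intro!: exI[of _ "d / 2"])
      show "((\<lambda>z. C * norm (z - w)) \<longlongrightarrow> 0) (at w)" by (auto intro!: tendsto_eq_intros)
    qed
    then show ?thesis unfolding has_field_derivative_iff by (auto simp: LIM_zero_iff)
  qed
  then have "I holomorphic_on - cis ` E"
    unfolding holomorphic_on_def field_differentiable_def
    by (meson ComplD has_field_derivative_at_within)
  then have "(\<lambda>z. I z / of_real (2 * pi)) holomorphic_on - cis ` E"
    by (intro holomorphic_intros) auto
  then show ?thesis by (simp add: I_def herglotz_def[abs_def])
qed

lemma herglotz_0: "herglotz E 0 = of_real (measure lborel E / (2 * pi))"
  using compact_E
  by (simp add: herglotz_def set_lebesgue_integral_def of_real_divide scaleR_conv_of_real)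

section \<open>Reflection in the unit circle and bounds for the real part\<close>

lemma inversion_notin:
  assumes "z \<notin> cis ` E"
  shows "1 / cnj z \<notin> cis ` E"
proof
  assume "1 / cnj z \<in> cis ` E"
  then obtain t where t: "t \<in> E" "1 / cnj z = cis t" by auto
  then have "cnj (1 / cnj z) = cnj (cis t)" by (simp only:)
  then have "1 / z = 1 / cis t" by (simp add: cis_cnj divide_inverse)
  then have "z = cis t" by simp
  with t assms show False by auto
qed

text \<open>Reflection in the circle turns the kernel into minus its conjugate, because
  \<open>cis t\<close> is fixed. This reduces the exterior of the disc and the circle itself to the
  disc.\<close>

lemma herglotz_inversion:
  assumes "z \<notin> cis ` E" "z \<noteq> 0"
  shows "herglotz E (1 / cnj z) = - cnj (herglotz E z)"
proof -
  have *: "(cis t + 1 / cnj z) / (cis t - 1 / cnj z) = - cnj ((cis t + z) / (cis t - z))" if "t \<in> E" for t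
  proof -
    have nz: "cis t - z \<noteq> 0" "cis t - 1 / cnj z \<noteq> 0" using assms(1) inversion_notin[OF assms(1)] that by force+
    have nz': "cis (- t) - cnj z \<noteq> 0" using nz(1) by (metis cis_cnj complex_cnj_cancel_iff eq_iff_diff_eq_0)
    have c: "cis t * cis (- t) = 1" by (simp add: cis_mult)
    have "(cis t + 1 / cnj z) * (cis (- t) - cnj z) = - ((cis (- t) + cnj z) * (cis t - 1 / cnj z))"
      using assms(2) c by (simp add: algebra_simps)
    then have "(cis t + 1 / cnj z) / (cis t - 1 / cnj z) = (- (cis (- t) + cnj z)) / (cis (- t) - cnj z)"
      by (simp only: frac_eq_eq[OF nz(2) nz'] mult_minus_left)
    then show ?thesis by (simp only: complex_cnj_divide complex_cnj_add complex_cnj_diff cis_cnj minus_divide_left)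
  qed
  have "(LINT t:E|lborel. (cis t + 1 / cnj z) / (cis t - 1 / cnj z)) = (LINT t:E|lborel. - cnj ((cis t + z) / (cis t - z)))"
    using borel_compact[OF compact_E] * by (intro set_lebesgue_integral_cong) auto
  also have "\<dots> = - (LINT t:E|lborel. cnj ((cis t + z) / (cis t - z)))"
    using set_integral_uminus[OF set_integrable_compact[OF compact_E]] assms
      continuous_on_cnj[OF continuous_kernel] by fastforce
  also have "(LINT t:E|lborel. cnj ((cis t + z) / (cis t - z))) = cnj (LINT t:E|lborel. (cis t + z) / (cis t - z))"
    unfolding set_lebesgue_integral_def
    by (simp only: complex_cnj_scaleR[symmetric] Bochner_Integration.integral_cnj)
  finally show ?thesis by (simp add: herglotz_def)
qed

text \<open>The Poisson kernel is nonnegative, so the integral over \<open>E\<close> lies between 0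
  and the total mass.\<close>

lemma Re_herglotz_disc:
  assumes "norm z < 1"
  shows "Re (herglotz E z) \<in> {0..1}"
proof -
  have ne: "cis t \<noteq> z" for t using assms by auto
  have int: "set_integrable lborel F (\<lambda>t. Re ((cis t + z) / (cis t - z)))"
           "set_integrable lborel F (\<lambda>t. (cis t + z) / (cis t - z))" if "compact F" for F
    using ne that by (auto intro!: set_integrable_compact continuous_intros)
  have Re: "Re (LINT t:F|lborel. (cis t + z) / (cis t - z)) = (LINT t:F|lborel. Re ((cis t + z) / (cis t - z)))" if "compact F" for F
    using int(2)[OF that] unfolding set_lebesgue_integral_def set_integrable_def
    by (subst integral_Re[symmetric]) auto
  have pos: "0 \<le> Re ((cis t + z) / (cis t - z))" for t
    using Re_herglotz_kernel[of "cis t" z] ne assms by (simp add: power_le_one)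
  have "0 \<le> (LINT t:E|lborel. Re ((cis t + z) / (cis t - z)))"
    unfolding set_lebesgue_integral_def using pos by (intro integral_nonneg_AE AE_I2) (auto simp: indicator_def)
  moreover have "(LINT t:E|lborel. Re ((cis t + z) / (cis t - z))) \<le> (LINT t:{0..2*pi}|lborel. Re ((cis t + z) / (cis t - z)))"
    unfolding set_lebesgue_integral_def using int(1)[OF compact_E] int(1)[of "{0..2*pi}"] pos E_subset
    by (intro integral_mono) (auto simp: indicator_def set_integrable_def)
  moreover have "(LINT t:{0..2*pi}|lborel. Re ((cis t + z) / (cis t - z))) = 2 * pi"
    by (subst Re[symmetric]) (simp_all add: herglotz_kernel_integral_full[OF assms])
  moreover have "Re (herglotz E z) = (LINT t:E|lborel. Re ((cis t + z) / (cis t - z))) / (2 * pi)"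
    unfolding herglotz_def by (subst Re_divide_of_real) (simp only: Re[OF compact_E])
  ultimately show ?thesis by simp
qed

text \<open>Reflection changes the sign of the real part, so the disc bound carries over to the
  exterior; on the circle the value is its own reflection and hence purely imaginary.\<close>

lemma abs_Re_herglotz_le_1:
  assumes z: "z \<notin> cis ` E"
  shows "\<bar>Re (herglotz E z)\<bar> \<le> 1"
proof -
  consider "norm z < 1" | "norm z > 1" | "norm z = 1" by linarith
  then show ?thesis
  proof cases
    case 1
    then show ?thesis using Re_herglotz_disc[of z] by auto
  next
    case 2
    then have z0: "z \<noteq> 0" "norm (1 / cnj z) < 1" by (auto simp: norm_divide divide_less_eq)
    show ?thesis using Re_herglotz_disc[OF z0(2)] herglotz_inversion[OF z z0(1)] by auto
  next
    case 3
    then have "herglotz E z = - cnj (herglotz E z)"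
      using herglotz_inversion[OF z] inversion_circle[OF 3] by force
    then have "Re (herglotz E z) = Re (- cnj (herglotz E z))" by (rule arg_cong)
    then show ?thesis by simp
  qed
qed

text \<open>The argument of the value is \<open>pi / 2\<close> times the real part of the Herglotz
  integral, so the strip of width 2 goes to the right half-plane. Circle points off
  \<open>E\<close>, where that real part is 0, go to the real axis.\<close>

definition half_plane_map :: "complex \<Rightarrow> complex" where
  "half_plane_map z = exp (\<i> * of_real (pi / 2) * herglotz E z)"

lemma half_plane_map_holomorphic: "half_plane_map holomorphic_on - cis ` E"
  unfolding half_plane_map_def by (intro holomorphic_intros herglotz_holomorphic)

lemma half_plane_map_0: "half_plane_map 0 = cis (measure lborel E / 4)"
  by (simp add: half_plane_map_def herglotz_0 cis_conv_exp)

lemma Re_half_plane_map: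
  assumes "z \<notin> cis ` E"
  shows "0 \<le> Re (half_plane_map z)"
proof -
  have "pi / 2 * \<bar>Re (herglotz E z)\<bar> \<le> pi / 2 * 1"
    using abs_Re_herglotz_le_1[OF assms] by (intro mult_left_mono) auto
  then have "\<bar>pi / 2 * Re (herglotz E z)\<bar> \<le> pi / 2" by (simp only: abs_mult) simp
  then have "0 \<le> cos (pi / 2 * Re (herglotz E z))"
    unfolding abs_le_iff by (intro cos_ge_zero) linarith+
  then show ?thesis by (simp add: half_plane_map_def Re_exp)
qed

lemma half_plane_map_inversion:
  assumes "z \<notin> cis ` E" "z \<noteq> 0"
  shows "half_plane_map (1 / cnj z) = cnj (half_plane_map z)"
  by (simp add: half_plane_map_def herglotz_inversion[OF assms] exp_cnj)

lemma half_plane_map_circle: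
  assumes z: "z \<notin> cis ` E" "norm z = 1"
  shows "half_plane_map z \<in> \<real>" "half_plane_map z \<noteq> 0"
proof -
  have "z \<noteq> 0" "1 / cnj z = z" using z(2) inversion_circle by auto
  then show "half_plane_map z \<in> \<real>" using half_plane_map_inversion[OF z(1)] by (simp add: Reals_cnj_iff)
  show "half_plane_map z \<noteq> 0" by (simp add: half_plane_map_def)
qed

end

section \<open>Self-reciprocal polynomials: the bound for the leading coefficient\<close>

text \<open>The quotient \<open>(a - cnj b) / (a + b)\<close> is the Blaschke factor of the right
  half-plane with its zero at \<open>cnj b\<close>; the squared moduli of its two terms differ by
  \<open>4 * Re a * Re b\<close>.\<close>

lemma norm_diff_cnj_le:
  assumes "0 \<le> Re a" "0 \<le> Re b"
  shows "norm (a - cnj b) \<le> norm (a + b)"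
proof -
  have "(norm (a + b))\<^sup>2 = (norm (a - cnj b))\<^sup>2 + 4 * Re a * Re b"
    unfolding cmod_power2 by (simp add: power2_eq_square algebra_simps)
  then have "(norm (a - cnj b))\<^sup>2 \<le> (norm (a + b))\<^sup>2" using assms by simp
  then show ?thesis by (rule power2_le_imp_le) simp
qed

text \<open>An entire function with this symmetry grows at most like the power \<open>2 * n\<close>,
  so it is a polynomial in disguise. The closed interval of angles makes \<open>E\<close> compact,
  and the bound on its measure keeps \<open>q\<close> off the imaginary axis.\<close>

locale self_reciprocal =
  fixes p :: "complex \<Rightarrow> complex" and n :: nat and E :: "real set"
  assumes n: "n \<ge> 1" and p_hol: "p holomorphic_on UNIV" and p0: "p 0 \<noteq> 0"
    and p_inv: "\<And>z. z \<noteq> 0 \<Longrightarrow> p (1 / cnj z) = cnj (p z / z ^ (2 * n))"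
  defines "E \<equiv> {t \<in> {0..2*pi}. norm (p (cis t)) \<le> 1}"
  assumes measure_E: "measure lborel E < 2 * pi"
begin

sublocale circle_set E
proof
  have "continuous_on UNIV p" using p_hol by (rule holomorphic_on_imp_continuous_on)
  then have "continuous_on {0..2*pi} (\<lambda>t. norm (p (cis t)))"
    by (intro continuous_on_norm continuous_on_compose2[of UNIV p "{0..2*pi}" cis]) (auto intro!: continuous_intros)
  then have "closed ({0..2*pi} \<inter> (\<lambda>t. norm (p (cis t))) -` {..1})"
    by (intro continuous_closed_preimage) auto
  moreover have "{0..2*pi} \<inter> (\<lambda>t. norm (p (cis t))) -` {..1} = E" by (auto simp: E_def)
  ultimately have "closed E" by simp
  moreover have "bounded E" by (rule bounded_subset[of "{0..2*pi}"]) (auto simp: E_def)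
  ultimately show "compact E" by (simp add: compact_eq_bounded_closed)
  show "E \<subseteq> {0..2*pi}" by (auto simp: E_def)
qed

abbreviation "x \<equiv> half_plane_map"

definition "F z = p z / z ^ n"
definition "\<alpha> = measure lborel E / 4"
definition "q = cis \<alpha>"
text \<open>Both \<open>A\<close> and \<open>B\<close> are products of two Blaschke factors of the
  half-plane. In \<open>B\<close> the zeros are at \<open>q\<close> and \<open>cnj q\<close>, the
  values of \<open>x\<close> at the origin and in the limit at infinity; in \<open>A\<close> both
  zeros are at \<open>cnj q\<close>, so \<open>A\<close> can be nonzero at the origin.\<close>

definition "A z = ((x z - cnj q) / (x z + q))\<^sup>2"
definition "B z = (x z - q) * (x z - cnj q) / ((x z + q) * (x z + cnj q))"
text \<open>The points that \<open>F\<close> maps off [-1, 1], together with its pole 0. The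
  reciprocal \<open>z ^ n / p z\<close> of \<open>F\<close> is used here and in \<open>k\<close>
  because it is regular at 0; away from 0, \<open>k z\<close> is \<open>z ^ n\<close> times the
  Joukowski root of \<open>F z\<close>.\<close>

definition "V = {z. p z \<noteq> 0 \<and> 1 - (z ^ n / p z)\<^sup>2 \<notin> \<real>\<^sub>\<le>\<^sub>0}"
definition "k z = p z * (1 + csqrt (1 - (z ^ n / p z)\<^sup>2))"

section \<open>The complement of the cut and the branch \<open>k\<close>\<close>

lemma alpha_bounds: "0 \<le> \<alpha>" "\<alpha> < pi / 2"
  using measure_E by (auto simp: \<alpha>_def)

lemma Re_q: "Re q > 0"
  using alpha_bounds by (auto simp: q_def intro!: cos_gt_zero_pi)

lemma F_inversion: "z \<noteq> 0 \<Longrightarrow> F (1 / cnj z) = cnj (F z)"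
  by (simp add: F_def p_inv power_divide field_simps power_mult power2_eq_square)

lemma F_real: "norm z = 1 \<Longrightarrow> F z \<in> \<real>"
  using F_inversion[of z] inversion_circle[of z] by (metis Reals_cnj_iff norm_zero zero_neq_one)

lemma mem_cis_E_iff: "z \<in> cis ` E \<longleftrightarrow> norm z = 1 \<and> norm (F z) \<le> 1"
proof
  assume "z \<in> cis ` E"
  then show "norm z = 1 \<and> norm (F z) \<le> 1" by (auto simp: E_def F_def norm_divide norm_power)
next
  assume z: "norm z = 1 \<and> norm (F z) \<le> 1"
  have "z = cis (Arg2pi z)" using z Arg2pi_eq[of z] by (simp add: cis_conv_exp)
  moreover have "Arg2pi z \<in> {0..2*pi}" using Arg2pi_ge_0[of z] Arg2pi_lt_2pi[of z] by auto
  ultimately show "z \<in> cis ` E"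
    using z by (intro image_eqI[of _ _ "Arg2pi z"]) (auto simp: E_def F_def norm_divide norm_power)
qed

lemma V_eq: "z \<noteq> 0 \<Longrightarrow> z \<in> V \<longleftrightarrow> F z \<noteq> 0 \<and> 1 - 1 / (F z)\<^sup>2 \<notin> \<real>\<^sub>\<le>\<^sub>0"
  by (simp add: V_def F_def power_divide)

lemma zero_in_V: "0 \<in> V"
  using n p0 by (simp add: V_def power_0_left)

lemma not_in_V:
  assumes "z \<notin> V"
  shows "z \<noteq> 0" "joukowski_modulus (F z) = 1"
proof -
  show "z \<noteq> 0" using assms zero_in_V by auto
  then show "joukowski_modulus (F z) = 1" using assms by (intro joukowski_modulus_eq_1) (auto simp: V_eq)
qed

text \<open>On the circle \<open>F\<close> takes real values \<open>r\<close>, and for nonzero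
  \<open>r\<close> the cut condition \<open>1 - 1 / r\<^sup>2 \<le> 0\<close> says that the modulus
  of \<open>r\<close> is at most 1.\<close>

lemma circle_mem_V_iff:
  assumes "norm z = 1"
  shows "z \<in> V \<longleftrightarrow> z \<notin> cis ` E"
proof -
  have z0: "z \<noteq> 0" using assms by auto
  obtain r where r: "F z = of_real r" using F_real[OF assms] by (auto elim: Reals_cases)
  have e: "1 - 1 / (F z)\<^sup>2 = of_real (1 - 1 / r\<^sup>2)" by (simp add: r)
  have "1 - 1 / (F z)\<^sup>2 \<in> \<real>\<^sub>\<le>\<^sub>0 \<longleftrightarrow> 1 - 1 / r\<^sup>2 \<le> 0"
    unfolding e by (simp only: nonpos_Reals_of_real_iff)
  also have "r \<noteq> 0 \<Longrightarrow> \<dots> \<longleftrightarrow> r\<^sup>2 \<le> 1" by (simp add: le_divide_eq)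
  also have "r\<^sup>2 \<le> 1 \<longleftrightarrow> \<bar>r\<bar> \<le> 1" using abs_le_square_iff[of r 1] by simp
  finally have *: "r \<noteq> 0 \<Longrightarrow> 1 - 1 / (F z)\<^sup>2 \<in> \<real>\<^sub>\<le>\<^sub>0 \<longleftrightarrow> \<bar>r\<bar> \<le> 1" .
  have "norm (F z) = \<bar>r\<bar>" by (simp add: r)
  then show ?thesis using assms * by (cases "r = 0") (auto simp: V_eq[OF z0] mem_cis_E_iff r)
qed

lemma V_subset: "V \<subseteq> - cis ` E"
  using circle_mem_V_iff mem_cis_E_iff by blast

lemma ball_subset: "ball 0 1 \<subseteq> - cis ` E"
  by auto

lemma p_continuous: "continuous_on S p"
  using p_hol holomorphic_on_imp_continuous_on continuous_on_subset by blast

lemma open_V: "open V"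
proof -
  have "open {z. p z \<noteq> 0}"
    by (intro open_Collect_neq p_continuous continuous_intros)
  then have "open ({z. p z \<noteq> 0} \<inter> (\<lambda>z. 1 - (z ^ n / p z)\<^sup>2) -` (- \<real>\<^sub>\<le>\<^sub>0))"
    by (intro continuous_open_preimage continuous_intros p_continuous) auto
  moreover have "{z. p z \<noteq> 0} \<inter> (\<lambda>z. 1 - (z ^ n / p z)\<^sup>2) -` (- \<real>\<^sub>\<le>\<^sub>0) = V"
    by (auto simp: V_def)
  ultimately show ?thesis by simp
qed

lemma k_holomorphic: "k holomorphic_on V"
proof -
  have "p holomorphic_on V" using p_hol holomorphic_on_subset by blast
  then show ?thesis unfolding k_def
    by (intro holomorphic_intros) (auto simp: V_def)
qed

lemma k_0: "k 0 = 2 * p 0"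
  using n by (simp add: k_def power_0_left)

lemma k_eq:
  assumes "z \<in> V" "z \<noteq> 0"
  shows "k z = z ^ n * joukowski_inv (F z)" "F z \<noteq> 0"
  using assms by (auto simp: k_def F_def V_def joukowski_inv_def power_divide)

lemma norm_k:
  assumes "z \<in> V" "z \<noteq> 0"
  shows "norm (k z) = norm z ^ n * joukowski_modulus (F z)"
  using k_eq[OF assms] by (simp add: norm_mult norm_power norm_joukowski_inv)

section \<open>Blaschke products in the half-plane\<close>

lemma x_plus_nonzero:
  assumes "z \<notin> cis ` E"
  shows "x z + q \<noteq> 0" "x z + cnj q \<noteq> 0"
proof -
  have "Re (x z + q) > 0" "Re (x z + cnj q) > 0"
    using Re_half_plane_map[OF assms] Re_q by auto
  then show "x z + q \<noteq> 0" "x z + cnj q \<noteq> 0" by force+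
qed

lemma norm_A_le: "z \<notin> cis ` E \<Longrightarrow> norm (A z) \<le> 1"
  using norm_diff_cnj_le[of "x z" q] Re_half_plane_map[of z] Re_q x_plus_nonzero[of z]
  by (simp add: A_def norm_power norm_divide power_le_one)

lemma norm_B_le:
  assumes "z \<notin> cis ` E"
  shows "norm (B z) \<le> 1"
proof -
  have "norm (x z - q) * norm (x z - cnj q) \<le> norm (x z + cnj q) * norm (x z + q)"
    using norm_diff_cnj_le[of "x z" q] norm_diff_cnj_le[of "x z" "cnj q"] Re_half_plane_map[OF assms] Re_q
    by (intro mult_mono) auto
  then show ?thesis
    using x_plus_nonzero[OF assms] by (simp add: B_def norm_divide norm_mult mult.commute)
qed

lemma A_holomorphic: "A holomorphic_on - cis ` E"
  unfolding A_def using x_plus_nonzero by (intro holomorphic_intros half_plane_map_holomorphic) auto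

lemma B_holomorphic: "B holomorphic_on - cis ` E"
  unfolding B_def using x_plus_nonzero by (intro holomorphic_intros half_plane_map_holomorphic) auto

lemma x_0: "x 0 = q"
  by (simp add: half_plane_map_0 q_def \<alpha>_def)

lemma B_0: "B 0 = 0"
  by (simp add: B_def x_0)

text \<open>Since \<open>x 0 = q\<close> is unimodular, the base of the square is
  \<open>(q - cnj q) / (2 * q)\<close>, of modulus \<open>sin \<alpha>\<close>. This is how the
  measure of \<open>E\<close> enters the final bound.\<close>

lemma norm_A_0: "norm (A 0) = (sin \<alpha>)\<^sup>2"
proof -
  have "q - cnj q = of_real (2 * sin \<alpha>) * \<i>" by (auto simp: q_def complex_eq_iff)
  then have "norm (q - cnj q) = 2 * \<bar>sin \<alpha>\<bar>" by (simp add: norm_mult)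
  moreover have "norm (q + q) = 2" unfolding mult_2[symmetric] norm_mult by (simp add: q_def)
  ultimately show ?thesis by (simp add: A_def x_0 norm_power norm_divide)
qed

text \<open>Reflection conjugates \<open>x\<close>, which merely exchanges the factors belonging to
  \<open>q\<close> and \<open>cnj q\<close>.\<close>

lemma norm_B_inversion: "z \<notin> cis ` E \<Longrightarrow> z \<noteq> 0 \<Longrightarrow> norm (B (1 / cnj z)) = norm (B z)"
proof -
  assume "z \<notin> cis ` E" "z \<noteq> 0"
  then have "B (1 / cnj z) = cnj (B z)"
    by (simp add: B_def half_plane_map_inversion mult.commute)
  then show ?thesis by simp
qed

text \<open>Here \<open>x z\<close> is real and hence equally far from \<open>q\<close> and
  \<open>cnj q\<close>. This links the estimate on the sphere, made with \<open>B\<close>, to the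
  one on the disc, made with \<open>A\<close>. Reality of \<open>B z\<close> later reduces an
  unknown unimodular constant to a sign.\<close>

lemma circle_A_B:
  assumes "norm z = 1" "z \<notin> cis ` E"
  shows "norm (A z) = norm (B z)" "B z \<in> \<real>"
proof -
  obtain r where r: "x z = of_real r" using half_plane_map_circle[OF assms(2,1)] by (auto elim: Reals_cases)
  have c: "x z - cnj q = cnj (x z - q)" "x z + cnj q = cnj (x z + q)" by (simp_all add: r)
  then have nn: "norm (x z - cnj q) = norm (x z - q)" "norm (x z + cnj q) = norm (x z + q)" by (metis complex_mod_cnj)+
  show "norm (A z) = norm (B z)"
    unfolding A_def B_def norm_mult norm_divide norm_power nn by (simp add: power2_eq_square)
  have "B z = of_real ((norm (x z - q))\<^sup>2 / (norm (x z + q))\<^sup>2)"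
    unfolding B_def c of_real_divide complex_norm_square by (rule refl)
  then show "B z \<in> \<real>" by simp
qed

text \<open>Although \<open>k\<close> may jump across the cut, the modulus is continuous there and
  equals 1; this supplies the boundary condition of the maximum principle.\<close>

lemma tendsto_joukowski_modulus_F:
  assumes "w \<notin> V"
  shows "((\<lambda>z. joukowski_modulus (F z)) \<longlongrightarrow> 1) (at w)"
proof -
  have "isCont F w" unfolding F_def using not_in_V(1)[OF assms] p_continuous[of UNIV]
    by (intro continuous_intros) (auto simp: continuous_on_eq_continuous_at)
  moreover have "isCont joukowski_modulus (F w)"
    using continuous_joukowski_modulus[of UNIV] by (auto simp: continuous_on_eq_continuous_at)
  ultimately have "isCont (\<lambda>z. joukowski_modulus (F z)) w" by (rule isCont_o2)
  then show ?thesis using not_in_V(2)[OF assms] by (simp add: isCont_def)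
qed

lemma eventually_joukowski_modulus_F_less:
  assumes "w \<notin> V" "e > 0"
  shows "eventually (\<lambda>z. joukowski_modulus (F z) ^ N < 1 + e) (at w within S)"
proof -
  have "((\<lambda>z. joukowski_modulus (F z) ^ N) \<longlongrightarrow> 1 ^ N) (at w)"
    by (intro tendsto_power tendsto_joukowski_modulus_F assms)
  then have "eventually (\<lambda>z. joukowski_modulus (F z) ^ N < 1 + e) (at w)"
    using assms(2) by (intro order_tendstoD(2)) auto
  then show ?thesis by (rule filter_leD[OF at_le[OF subset_UNIV]])
qed

text \<open>The extra factor \<open>B z\<close> makes the function vanish at the origin and, by inversion, at
  infinity; it disappears when the \<open>N\<close>-th root is taken.\<close>

lemma joukowski_modulus_power_le:
  assumes z: "z \<in> V" "z \<noteq> 0"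
  shows "joukowski_modulus (F z) ^ N * norm (B z) ^ (n * N + 1) \<le> 1"
proof -
  define \<Phi> where "\<Phi> z = joukowski_modulus (F z) ^ N * norm (B z) ^ (n * N + 1)" for z
  define g where "g z = (k z / z ^ n) ^ N * B z ^ (n * N + 1)" for z
  have norm_g: "norm (g z) = \<Phi> z" if "z \<in> V" "z \<noteq> 0" for z
    using that by (simp add: g_def \<Phi>_def norm_mult norm_power norm_divide norm_k)
  have \<Phi>_inv: "\<Phi> (1 / cnj z) = \<Phi> z" if "z \<notin> cis ` E" "z \<noteq> 0" for z
    using that by (simp add: \<Phi>_def F_inversion norm_B_inversion)
  \<comment> \<open>Near 0 the function is \<open>k z ^ N * (B z / z) ^ (n * N) * B z\<close>; the
    quotient tends to the derivative of \<open>B\<close>, and the surplus factor \<open>B z\<close>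
    forces the limit 0.\<close>
  have tend: "(g \<longlongrightarrow> 0) (at 0)"
  proof -
    have "isCont k 0" "isCont B 0"
      using k_holomorphic B_holomorphic open_V zero_in_V closed_cis_E
      by (auto intro!: continuous_on_interior dest!: holomorphic_on_imp_continuous_on simp: interior_open open_Compl)
    then have k: "(k \<longlongrightarrow> k 0) (at 0)" and Bt: "(B \<longlongrightarrow> 0) (at 0)" by (auto simp: isCont_def B_0)
    have "B field_differentiable at 0"
      using B_holomorphic closed_cis_E by (intro holomorphic_on_imp_differentiable_at[of _ "- cis ` E"]) (auto simp: open_Compl)
    then obtain D where "(B has_field_derivative D) (at 0)" by (auto simp: field_differentiable_def)
    then have D: "((\<lambda>z. B z / z) \<longlongrightarrow> D) (at 0)" by (simp add: has_field_derivative_iff B_0)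
    have "((\<lambda>z. k z ^ N * (B z / z) ^ (n * N) * B z) \<longlongrightarrow> k 0 ^ N * D ^ (n * N) * 0) (at 0)"
      by (intro tendsto_intros k Bt D)
    moreover have "eventually (\<lambda>z. k z ^ N * (B z / z) ^ (n * N) * B z = g z) (at 0)"
      unfolding eventually_at_filter
      by (rule always_eventually) (auto simp: g_def power_divide power_mult)
    ultimately show ?thesis by (simp add: tendsto_cong)
  qed
  have "norm (g z) \<le> 1 + e" if e: "e > 0" for e
  proof -
    have "eventually (\<lambda>z. norm (g z) < 1 + e) (at 0)"
      using e by (intro order_tendstoD(2)[OF tendsto_norm[OF tend]]) auto
    moreover have "eventually (\<lambda>z. z \<in> V) (at 0)"
      using open_V zero_in_V eventually_at_topological by blast
    ultimately have "eventually (\<lambda>z. z \<in> V \<and> norm (g z) < 1 + e) (at 0)" by eventually_elim auto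
    then obtain d where d: "d > 0" "\<And>z. z \<noteq> 0 \<Longrightarrow> norm z < d \<Longrightarrow> z \<in> V \<and> norm (g z) < 1 + e"
      unfolding eventually_at by auto
    show ?thesis
    proof (rule maximum_modulus_unbounded[where g = g and U = "V - {0}" and R = "1 / d"])
      show "open (V - {0})" using open_V by auto
      show "g holomorphic_on V - {0}" unfolding g_def using V_subset
        by (intro holomorphic_intros holomorphic_on_subset[OF k_holomorphic] holomorphic_on_subset[OF B_holomorphic]) auto
      show "z \<in> V - {0}" using z by simp
      \<comment> \<open>Large \<open>w\<close> are reflected into the small punctured disc about 0,
        where the bound is already known.\<close>
      show "norm (g w) < 1 + e" if w: "w \<in> V - {0}" "norm w > 1 / d" for w
      proof -
        have w0: "w \<noteq> 0" "w \<notin> cis ` E" using w V_subset by auto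
        have "norm (1 / cnj w) < d" using w d(1) w0 by (simp add: norm_divide field_simps)
        with d(2)[of "1 / cnj w"] have "1 / cnj w \<in> V" "norm (g (1 / cnj w)) < 1 + e" using w0 by auto
        then show ?thesis using norm_g \<Phi>_inv[OF w0(2,1)] w w0 by simp
      qed
      show "eventually (\<lambda>z. norm (g z) < 1 + e) (at w within V - {0})" if "w \<notin> V - {0}" for w
      proof (cases "w = 0")
        case True
        show ?thesis
          by (rule filter_leD[OF at_le[OF subset_UNIV]]) (use \<open>eventually (\<lambda>z. norm (g z) < 1 + e) (at 0)\<close> True in simp)
      next
        case False
        then have "w \<notin> V" using that by auto
        then have "eventually (\<lambda>z. joukowski_modulus (F z) ^ N < 1 + e) (at w within V - {0})"
          using e by (rule eventually_joukowski_modulus_F_less)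
        moreover have "eventually (\<lambda>z. z \<in> V - {0}) (at w within V - {0})" by (simp add: eventually_at_filter)
        ultimately show ?thesis
        proof eventually_elim
          case (elim z)
          \<comment> \<open>Near the cut the modulus of the root is close to 1, and the power of
            \<open>B\<close> can only decrease the product.\<close>
          have "\<Phi> z \<le> joukowski_modulus (F z) ^ N * 1"
            unfolding \<Phi>_def using elim V_subset joukowski_modulus_ge_1[of "F z"]
            by (intro mult_left_mono power_le_one norm_B_le) auto
          then show ?case using elim norm_g by auto
        qed
      qed
    qed
  qed
  then have "norm (g z) \<le> 1" by (rule field_le_epsilon)
  then show ?thesis using norm_g[OF z] by (simp add: \<Phi>_def)
qed

text \<open>If the left-hand side \<open>u\<close> exceeded 1, then
  \<open>u ^ N * norm (B z) \<le> 1\<close> for all \<open>N\<close> would contradict the unbounded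
  growth of \<open>u ^ N\<close>.\<close>

lemma joukowski_modulus_B_le:
  assumes z: "z \<in> V" "z \<noteq> 0"
  shows "joukowski_modulus (F z) * norm (B z) ^ n \<le> 1"
proof (rule ccontr)
  define u where "u = joukowski_modulus (F z) * norm (B z) ^ n"
  assume "\<not> ?thesis"
  then have u: "u > 1" by (simp add: u_def)
  then have B: "norm (B z) > 0" using n by (auto simp: u_def power_0_left)
  obtain N where N: "1 / norm (B z) < u ^ N" using real_arch_pow[OF u] by blast
  have "u ^ N * norm (B z) \<le> 1"
    using joukowski_modulus_power_le[OF z, of N] by (simp add: u_def power_mult_distrib mult_ac flip: power_mult)
  with N B show False by (simp add: field_simps)
qed

text \<open>The maximum principle on the part of the disc in \<open>V\<close>. Its boundary points
  are either off \<open>V\<close>, where the modulus of the root tends to 1, or on the circle, where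
  \<open>A\<close> may be replaced by \<open>B\<close>.\<close>

lemma norm_k_A_le:
  assumes z: "z \<in> V" "norm z < 1"
  shows "norm (k z * A z ^ n) \<le> 1"
proof (rule field_le_epsilon)
  fix e :: real assume e: "e > 0"
  have norm_le: "norm (k z * A z ^ n) \<le> joukowski_modulus (F z)"
    if "z \<in> V" "norm z \<le> 1" "z \<noteq> 0" for z
  proof -
    have "norm (k z * A z ^ n) = (norm z ^ n * norm (A z) ^ n) * joukowski_modulus (F z)"
      using that by (simp add: norm_mult norm_power norm_k)
    also have "\<dots> \<le> 1 * joukowski_modulus (F z)"
      using that V_subset joukowski_modulus_ge_1[of "F z"] norm_A_le[of z]
      by (intro mult_right_mono mult_le_one power_le_one) auto
    finally show ?thesis by simp
  qed
  show "norm (k z * A z ^ n) \<le> 1 + e"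
  proof (rule maximum_modulus_unbounded[where U = "V \<inter> ball 0 1" and R = 1 and g = "\<lambda>z. k z * A z ^ n"])
    show "open (V \<inter> ball 0 1)" using open_V by auto
    show "(\<lambda>z. k z * A z ^ n) holomorphic_on V \<inter> ball 0 1" using V_subset
      by (intro holomorphic_intros holomorphic_on_subset[OF k_holomorphic] holomorphic_on_subset[OF A_holomorphic]) auto
    show "z \<in> V \<inter> ball 0 1" using z by simp
    fix w assume w: "w \<in> closure (V \<inter> ball 0 1)" "w \<notin> V \<inter> ball 0 1"
    have "closure (V \<inter> ball 0 1) \<subseteq> cball (0::complex) 1" by (intro closure_minimal) auto
    then have w1: "norm w \<le> 1" using w by auto
    show "eventually (\<lambda>z. norm (k z * A z ^ n) < 1 + e) (at w within V \<inter> ball 0 1)"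
    proof (cases "w \<in> V")
      case True
      then have nw: "norm w = 1" "w \<noteq> 0" "w \<notin> cis ` E" using w w1 V_subset by auto
      have "isCont k w" "isCont A w"
        using k_holomorphic A_holomorphic open_V True closed_cis_E nw
        by (auto intro!: continuous_on_interior dest!: holomorphic_on_imp_continuous_on simp: interior_open open_Compl)
      then have "isCont (\<lambda>z. norm (k z * A z ^ n)) w" by (intro continuous_intros)
      \<comment> \<open>At a circle point of \<open>V\<close> the moduli of \<open>A\<close> and
        \<open>B\<close> agree, so the bound on the sphere applies.\<close>
      moreover have "norm (k w * A w ^ n) \<le> 1"
        using joukowski_modulus_B_le[OF True nw(2)] circle_A_B[OF nw(1,3)] norm_k[OF True nw(2)] nw
        by (simp add: norm_mult norm_power)
      ultimately have "eventually (\<lambda>z. norm (k z * A z ^ n) < 1 + e) (at w)"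
        using e unfolding isCont_def by (intro order_tendstoD(2)) auto
      then show ?thesis by (rule filter_leD[OF at_le[OF subset_UNIV]])
    next
      case False
      then have "eventually (\<lambda>z. joukowski_modulus (F z) ^ 1 < 1 + e) (at w within V \<inter> ball 0 1)"
        using e by (rule eventually_joukowski_modulus_F_less)
      moreover have "eventually (\<lambda>z. z \<in> V \<inter> ball 0 1) (at w within V \<inter> ball 0 1)" by (simp add: eventually_at_filter)
      moreover have "eventually (\<lambda>z. z \<noteq> 0) (at w within V \<inter> ball 0 1)"
        using not_in_V(1)[OF False] by (intro eventually_neq_at_within)
      ultimately show ?thesis
      proof eventually_elim
        case (elim z)
        then show ?case using norm_le[of z] by auto
      qed
    qed
  qed auto
qed

theorem leading_coefficient_bound: "2 * norm (p 0) * sin \<alpha> ^ (2 * n) \<le> 1"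
  using norm_k_A_le[OF zero_in_V] by (simp add: k_0 norm_mult norm_power norm_A_0 power_mult)

end

section \<open>Self-reciprocal polynomials: the case of equality\<close>

text \<open>A complex copy of the Chebyshev recurrence, so that the identity for \<open>F\<close>
  can be stated inside the disc before it is restricted to the circle.\<close>

fun cheb_complex :: "nat \<Rightarrow> complex \<Rightarrow> complex" where
  "cheb_complex 0 z = 1"
| "cheb_complex (Suc 0) z = z"
| "cheb_complex (Suc (Suc m)) z = 2 * z * cheb_complex (Suc m) z - cheb_complex m z"

lemma cheb_complex_of_real: "cheb_complex m (of_real r) = of_real (cheb_T m r)"
  by (induction m r rule: cheb_T.induct) auto

lemma cheb_complex_joukowski:
  assumes "w \<noteq> 0"
  shows "cheb_complex m ((w + 1 / w) / 2) = (w ^ m + 1 / w ^ m) / 2"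
proof (induction m rule: induct_nat_012)
  case (ge2 m)
  have "(w + 1 / w) * (w ^ Suc m + 1 / w ^ Suc m) = w ^ Suc (Suc m) + 1 / w ^ Suc (Suc m) + (w ^ m + 1 / w ^ m)"
    using assms by (simp add: field_simps)
  moreover have "2 * (c / 2) * (a / 2) - b / 2 = (c * a - b) / 2" for a b c :: complex
    by (simp add: diff_divide_distrib)
  ultimately show ?case unfolding cheb_complex.simps ge2 by (simp only: add_diff_cancel_right')
qed auto

lemma continuous_cheb_complex [continuous_intros]:
  "continuous_on S g \<Longrightarrow> continuous_on S (\<lambda>z. cheb_complex m (g z))"
  by (induction m rule: induct_nat_012) (auto intro!: continuous_intros)

lemma continuous_constant_limit:
  fixes g :: "'a::t2_space \<Rightarrow> 'b::t1_space"
  assumes "isCont g w" "w islimpt S" "\<And>z. z \<in> S \<Longrightarrow> g z = c"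
  shows "g w = c"
proof (rule ccontr)
  assume "g w \<noteq> c"
  then have "eventually (\<lambda>z. g z \<noteq> c) (at w)"
    using assms(1) tendsto_imp_eventually_ne unfolding isCont_def by blast
  moreover have "frequently (\<lambda>z. z \<in> S) (at w)" using assms(2) by (simp add: islimpt_conv_frequently_at)
  ultimately have "frequently (\<lambda>z. z \<in> S \<and> g z \<noteq> c) (at w)" by (intro frequently_eventually_frequently)
  then show False using assms(3) by (auto dest: frequently_ex)
qed

lemma circle_islimpt_ball:
  assumes "norm (w :: complex) = 1"
  shows "w islimpt (ball 0 1 - {0})"
proof -
  have "w \<in> closure (ball 0 1)" using assms by simp
  then have "w islimpt ball 0 1" using assms by (auto simp: closure_def)
  moreover have "ball 0 1 = insert 0 (ball (0::complex) 1 - {0})" by auto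
  ultimately show ?thesis by (metis islimpt_insert)
qed

text \<open>Both sides equal \<open>2 * (x\<^sup>2 + 1)\<^sup>2 / P - 1\<close>. With
  \<open>q'\<close> as the conjugate of \<open>q\<close>, it makes the Joukowski image of
  \<open>B\<close> affine in \<open>v + 1 / v\<close>, where \<open>v\<close> is a Moebius function
  of the square of \<open>x\<close>.\<close>

lemma joukowski_B_identity:
  fixes x q q' v :: complex
  assumes qq: "q * q' = 1" and D: "(x + q) * (x + q') \<noteq> 0" and N: "(x - q) * (x - q') \<noteq> 0"
    and v: "v = q'\<^sup>2 * (x\<^sup>2 - q\<^sup>2) / (x\<^sup>2 - q'\<^sup>2)" and ne: "q \<noteq> q'"
  defines "b \<equiv> (x - q) * (x - q') / ((x + q) * (x + q'))"
  shows "(b + 1 / b) / 2 = - 1 + 2 * (v + 1 / v - 2) / (q - q')\<^sup>2"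
proof -
  define P where "P = (x\<^sup>2 - q\<^sup>2) * (x\<^sup>2 - q'\<^sup>2)"
  have P: "P = ((x - q) * (x - q')) * ((x + q) * (x + q'))"
    by (simp add: P_def power2_eq_square algebra_simps)
  have P0: "P \<noteq> 0" using D N by (simp add: P)
  then have nz: "x\<^sup>2 - q\<^sup>2 \<noteq> 0" "x\<^sup>2 - q'\<^sup>2 \<noteq> 0" by (auto simp: P_def)
  have q0: "q' \<noteq> 0" using qq by auto
  have b0: "b \<noteq> 0" using D N by (simp add: b_def)
  have "b + 1 = ((x - q) * (x - q') + (x + q) * (x + q')) / ((x + q) * (x + q'))"
    using D by (simp add: b_def add_divide_distrib)
  \<comment> \<open>The mixed terms cancel, and \<open>q * q' = 1\<close> gives the constant
    term.\<close>
  also have "(x - q) * (x - q') + (x + q) * (x + q') = 2 * (x\<^sup>2 + 1)"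
    using qq by (simp add: power2_eq_square algebra_simps)
  finally have b1: "b + 1 = 2 * (x\<^sup>2 + 1) / ((x + q) * (x + q'))" .
  have frac: "(2 * Y / d)\<^sup>2 / (2 * (m / d)) = 2 * Y\<^sup>2 / (m * d)" if "m \<noteq> 0" "d \<noteq> 0" for Y d m :: complex
    using that by (simp add: field_simps power2_eq_square)
  have "(b + 1 / b) / 2 + 1 = (b + 1)\<^sup>2 / (2 * b)"
    using b0 by (simp add: field_simps power2_eq_square)
  also have "\<dots> = 2 * (x\<^sup>2 + 1)\<^sup>2 / P"
    unfolding b1 unfolding b_def P using N D by (rule frac)
  finally have 1: "(b + 1 / b) / 2 + 1 = 2 * (x\<^sup>2 + 1)\<^sup>2 / P" .
  have v0: "v \<noteq> 0" using nz q0 by (simp add: v)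
  have "v - 1 = (q'\<^sup>2 * (x\<^sup>2 - q\<^sup>2) - (x\<^sup>2 - q'\<^sup>2)) / (x\<^sup>2 - q'\<^sup>2)"
    using nz by (simp add: v diff_divide_distrib)
  also have "q'\<^sup>2 * (x\<^sup>2 - q\<^sup>2) - (x\<^sup>2 - q'\<^sup>2) = q' * (q' - q) * (x\<^sup>2 + 1)"
    using qq by algebra
  finally have v1: "v - 1 = q' * (q' - q) * (x\<^sup>2 + 1) / (x\<^sup>2 - q'\<^sup>2)" .
  have "v + 1 / v - 2 = (v - 1)\<^sup>2 / v"
    using v0 by (simp add: field_simps power2_eq_square)
  also have "\<dots> = (q' - q)\<^sup>2 * (x\<^sup>2 + 1)\<^sup>2 / P"
    unfolding v1 unfolding v P_def using nz q0 by (simp add: power_divide power_mult_distrib) (simp add: power2_eq_square mult_ac)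
  also have "(q' - q)\<^sup>2 = (q - q')\<^sup>2" by (rule power2_commute)
  finally have "2 * (v + 1 / v - 2) / (q - q')\<^sup>2 = 2 * (x\<^sup>2 + 1)\<^sup>2 / P" using ne by simp
  with 1 show ?thesis by (simp add: algebra_simps)
qed

context self_reciprocal
begin

section \<open>Rigidity in the two maximum principles\<close>

lemma isCont_kA:
  assumes "w \<in> V"
  shows "isCont (\<lambda>z. k z * A z ^ n) w"
proof -
  have "isCont k w" "isCont A w"
    using k_holomorphic A_holomorphic open_V assms closed_cis_E V_subset
    by (auto intro!: continuous_on_interior dest!: holomorphic_on_imp_continuous_on simp: interior_open open_Compl)
  then show ?thesis by (intro continuous_intros)
qed

text \<open>Equality means that the modulus 1 is attained at 0. The set \<open>W\<close> where the
  value at 0 is taken is open and closed in the disc; this shows at the same time that the whole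
  disc lies in \<open>V\<close>.\<close>

lemma extremal_kA_constant:
  assumes eq: "2 * norm (p 0) * sin \<alpha> ^ (2 * n) = 1"
  obtains \<gamma> where "norm \<gamma> = 1" "ball 0 1 \<subseteq> V" "\<And>z. norm z < 1 \<Longrightarrow> k z * A z ^ n = \<gamma>"
proof -
  define g where "g = (\<lambda>z. k z * A z ^ n)"
  have g0: "norm (g 0) = 1" using eq by (simp add: g_def k_0 norm_mult norm_power norm_A_0 power_mult)
  define W where "W = {z \<in> ball 0 1. z \<in> V \<and> g z = g 0}"
  have "open W"
    unfolding open_contains_ball
  proof
    fix w assume w: "w \<in> W"
    then have "w \<in> V \<inter> ball 0 1" "open (V \<inter> ball 0 1)" using open_V by (auto simp: W_def)
    then obtain r where r: "r > 0" "ball w r \<subseteq> V \<inter> ball 0 1" using open_contains_ball by blast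
    have "g constant_on ball w r"
    proof (rule maximum_modulus_principle[where U = "ball w r" and \<xi> = w])
      show "g holomorphic_on ball w r" unfolding g_def using V_subset r(2)
        by (intro holomorphic_intros holomorphic_on_subset[OF k_holomorphic] holomorphic_on_subset[OF A_holomorphic]) auto
      show "norm (g z) \<le> norm (g w)" if "z \<in> ball w r" for z
      proof -
        have "z \<in> V" "norm z < 1" using that r(2) by auto
        then have "norm (g z) \<le> 1" unfolding g_def by (rule norm_k_A_le)
        then show ?thesis using w g0 by (simp add: W_def)
      qed
    qed (use r(1) in auto)
    then obtain c where c: "\<And>z. z \<in> ball w r \<Longrightarrow> g z = c" by (auto simp: constant_on_def)
    have "g z = g 0" if "z \<in> ball w r" for z
      using c[of w] c[OF that] w r(1) by (simp add: W_def)
    then show "\<exists>e>0. ball w e \<subseteq> W" using r by (intro exI[of _ r]) (auto simp: W_def)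
  qed
  then have "openin (top_of_set (ball 0 1)) W" by (intro open_subset) (auto simp: W_def)
  moreover have "closedin (top_of_set (ball 0 1)) W"
    unfolding closedin_limpt
  proof (intro conjI allI impI)
    show "W \<subseteq> ball 0 1" by (auto simp: W_def)
    fix w assume w: "w islimpt W \<and> w \<in> ball 0 1"
    have fr: "frequently (\<lambda>z. z \<in> W) (at w)" using w by (simp add: islimpt_conv_frequently_at)
    have "w \<in> V"
    proof (rule ccontr)
      assume wV: "w \<notin> V"
      \<comment> \<open>Near a point off \<open>V\<close> inside the disc, \<open>k\<close> has
        modulus close to \<open>norm w ^ n\<close>, hence below 1, so points of \<open>W\<close>
        cannot accumulate there.\<close>
      have "norm w ^ n < 1" using w n by (simp add: power_less_one_iff)
      moreover have "((\<lambda>z. norm z ^ n * joukowski_modulus (F z)) \<longlongrightarrow> norm w ^ n * 1) (at w)"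
        by (intro tendsto_intros tendsto_joukowski_modulus_F wV)
      ultimately have "eventually (\<lambda>z. norm z ^ n * joukowski_modulus (F z) < 1) (at w)"
        by (intro order_tendstoD(2)) auto
      moreover have "eventually (\<lambda>z. z \<noteq> 0) (at w)"
        using not_in_V(1)[OF wV] by (intro eventually_neq_at_within)
      ultimately have "eventually (\<lambda>z. z \<noteq> 0 \<and> norm z ^ n * joukowski_modulus (F z) < 1) (at w)"
        by eventually_elim auto
      with fr have "frequently (\<lambda>z. z \<in> W \<and> z \<noteq> 0 \<and> norm z ^ n * joukowski_modulus (F z) < 1) (at w)"
        by (rule frequently_eventually_frequently)
      then obtain z where z: "z \<in> W" "z \<noteq> 0" "norm z ^ n * joukowski_modulus (F z) < 1"
        using frequently_ex by blast
      have "norm (g z) = norm (k z) * norm (A z) ^ n" by (simp add: g_def norm_mult norm_power)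
      also have "\<dots> \<le> norm (k z) * 1"
        using z V_subset by (intro mult_left_mono power_le_one norm_A_le) (auto simp: W_def)
      also have "\<dots> < 1" using z norm_k[of z] by (auto simp: W_def)
      finally show False using z g0 by (simp add: W_def)
    qed
    moreover have "g w = g 0"
      using isCont_kA[OF \<open>w \<in> V\<close>] w continuous_constant_limit[of w g W "g 0"]
      by (auto simp: W_def g_def)
    ultimately show "w \<in> W" using w by (simp add: W_def)
  qed
  ultimately have "W = {} \<or> W = ball 0 1"
    using connected_ball[of "0::complex" 1, unfolded connected_clopen] by simp
  moreover have "0 \<in> W" using zero_in_V by (simp add: W_def)
  ultimately have "W = ball 0 1" by auto
  then have W: "z \<in> W" if "norm z < 1" for z using that by simp
  show thesis
  proof (rule that[OF g0])
    show "ball 0 1 \<subseteq> V" using W by (auto simp: W_def)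
    show "k z * A z ^ n = g 0" if "norm z < 1" for z using W[OF that] by (simp add: W_def g_def)
  qed
qed

lemma circle_not_subset_cis_E: "\<exists>w. norm w = 1 \<and> w \<notin> cis ` E"
proof (rule ccontr)
  assume "\<not> ?thesis"
  then have "E = {0..2*pi}"
    unfolding E_def using mem_cis_E_iff by (force simp: F_def norm_divide norm_power)
  then show False using measure_E by simp
qed

text \<open>Constancy of the first function extends to a circle point \<open>w\<close> off
  \<open>E\<close>, where \<open>A\<close> and \<open>B\<close> have equal modulus. Thus the second
  function \<open>G\<close> attains its bound 1 at \<open>w\<close>, which makes it constant, and
  reality at \<open>w\<close> makes the constant a sign.\<close>

lemma extremal_kB_constant:
  assumes eq: "2 * norm (p 0) * sin \<alpha> ^ (2 * n) = 1"
  obtains e where "e = 1 \<or> e = (- 1 :: real)"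
    "\<And>z. norm z < 1 \<Longrightarrow> z \<noteq> 0 \<Longrightarrow> k z * B z ^ n = of_real e * z ^ n"
proof -
  obtain \<gamma> where \<gamma>: "norm \<gamma> = 1" "ball 0 1 \<subseteq> V" "\<And>z. norm z < 1 \<Longrightarrow> k z * A z ^ n = \<gamma>"
    using extremal_kA_constant[OF eq] by blast
  obtain w where w: "norm w = 1" "w \<notin> cis ` E" using circle_not_subset_cis_E by blast
  then have wV: "w \<in> V" "w \<noteq> 0" using circle_mem_V_iff by auto
  have "k w * A w ^ n = \<gamma>"
    by (rule continuous_constant_limit[OF isCont_kA[OF wV(1)] circle_islimpt_ball[OF w(1)]]) (use \<gamma>(3) in auto)
  then have "norm (k w) * norm (A w) ^ n = 1" using \<gamma>(1) by (metis norm_mult norm_power)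
  then have w1: "joukowski_modulus (F w) * norm (B w) ^ n = 1"
    using norm_k[OF wV] circle_A_B[OF w] w by simp
  define G where "G z = k z * B z ^ n / z ^ n" for z
  have norm_G: "norm (G z) = joukowski_modulus (F z) * norm (B z) ^ n" if "z \<in> V" "z \<noteq> 0" for z
    using that by (simp add: G_def norm_mult norm_divide norm_power norm_k)
  have "w \<in> V - {0}" "open (V - {0})" using wV open_V by auto
  then obtain r where r: "r > 0" "ball w r \<subseteq> V - {0}" using open_contains_ball by blast
  \<comment> \<open>The ball makes \<open>w\<close> an interior point of a connected open set that
    also contains the punctured disc.\<close>
  define S where "S = (ball 0 1 - {0}) \<union> ball w r"
  have S: "S \<subseteq> V - {0}" using \<gamma>(2) r(2) by (auto simp: S_def)
  have "frequently (\<lambda>z. z \<in> ball 0 1 - {0}) (at w)"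
    using circle_islimpt_ball[OF w(1)] by (simp add: islimpt_conv_frequently_at)
  moreover have "eventually (\<lambda>z. z \<in> ball w r) (at w)"
    using r(1) by (intro eventually_at_in_open') auto
  ultimately have "frequently (\<lambda>z. z \<in> ball 0 1 - {0} \<and> z \<in> ball w r) (at w)"
    by (rule frequently_eventually_frequently)
  then have meet: "(ball 0 1 - {0}) \<inter> ball w r \<noteq> {}" by (auto dest!: frequently_ex)
  have "G constant_on S"
  proof (rule maximum_modulus_principle[where U = S and \<xi> = w])
    show "G holomorphic_on S" unfolding G_def using S V_subset
      by (intro holomorphic_intros holomorphic_on_subset[OF k_holomorphic] holomorphic_on_subset[OF B_holomorphic]) auto
    show "open S" by (auto simp: S_def)
    show "connected S" unfolding S_def
      using meet by (intro connected_Un connected_punctured_ball) auto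
    show "w \<in> S" using r(1) by (simp add: S_def)
    show "norm (G z) \<le> norm (G w)" if "z \<in> S" for z
    proof -
      have "z \<in> V" "z \<noteq> 0" using that S by auto
      then show ?thesis using joukowski_modulus_B_le norm_G norm_G[OF wV] w1 by simp
    qed
  qed (use \<open>open (V - {0})\<close> in \<open>auto simp: S_def\<close>)
  then obtain c where c: "\<And>z. z \<in> S \<Longrightarrow> G z = c" by (auto simp: constant_on_def)
  have cw: "c = G w" using c[of w] r(1) by (simp add: S_def)
  have "G w = joukowski_inv (F w) * B w ^ n" using k_eq[OF wV] wV by (simp add: G_def)
  \<comment> \<open>The value \<open>F w\<close> is real and off [-1, 1], so the square root is
    taken of a positive number.\<close>
  moreover have "joukowski_inv (F w) \<in> \<real>"
  proof -
    obtain \<rho> where \<rho>: "F w = of_real \<rho>" using F_real[OF w(1)] by (auto elim: Reals_cases)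
    have e: "1 - 1 / (F w)\<^sup>2 = of_real (1 - 1 / \<rho>\<^sup>2)" by (simp add: \<rho>)
    have "1 - 1 / (F w)\<^sup>2 \<notin> \<real>\<^sub>\<le>\<^sub>0" using wV V_eq by blast
    then have "1 - 1 / \<rho>\<^sup>2 > 0" unfolding e by (simp only: nonpos_Reals_of_real_iff not_le)
    then have "csqrt (1 - 1 / (F w)\<^sup>2) = of_real (sqrt (1 - 1 / \<rho>\<^sup>2))" unfolding e by (subst csqrt_of_real_nonneg) auto
    then show ?thesis by (simp add: joukowski_inv_def \<rho>)
  qed
  ultimately have "G w \<in> \<real>" using circle_A_B(2)[OF w] by simp
  then obtain e where e: "c = of_real e" using cw by (auto elim: Reals_cases)
  have "\<bar>e\<bar> = 1" using norm_G[OF wV] w1 cw e by (metis norm_of_real)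
  then have "e = 1 \<or> e = - 1" by linarith
  moreover have "k z * B z ^ n = of_real e * z ^ n" if "norm z < 1" "z \<noteq> 0" for z
    using c[of z] that e by (auto simp: S_def G_def field_simps)
  ultimately show thesis using that by blast
qed

text \<open>Dividing the two constancy statements shows that \<open>z * A z / B z\<close> has a
  constant power. The quotient is \<open>z\<close> times a Moebius function of the square of
  \<open>x z\<close>, so that square is determined by \<open>z\<close>, and with it \<open>B\<close>
  and \<open>F\<close>.\<close>

lemma extremal_disc:
  assumes eq: "2 * norm (p 0) * sin \<alpha> ^ (2 * n) = 1"
  obtains e \<kappa> where "e = 1 \<or> e = (- 1 :: real)" "norm \<kappa> = 1"
    "\<And>z. norm z < 1 \<Longrightarrow> z \<noteq> 0 \<Longrightarrow>
      F z = of_real e * cheb_complex n (- 1 - (\<kappa> * z + 1 / (\<kappa> * z) - 2) / of_real (2 * (sin \<alpha>)\<^sup>2))"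
proof -
  obtain \<gamma> where \<gamma>: "norm \<gamma> = 1" "ball 0 1 \<subseteq> V" "\<And>z. norm z < 1 \<Longrightarrow> k z * A z ^ n = \<gamma>"
    using extremal_kA_constant[OF eq] by blast
  obtain e where e: "e = 1 \<or> e = (- 1 :: real)"
    "\<And>z. norm z < 1 \<Longrightarrow> z \<noteq> 0 \<Longrightarrow> k z * B z ^ n = of_real e * z ^ n"
    using extremal_kB_constant[OF eq] by blast
  have sin: "sin \<alpha> \<noteq> 0" using eq n by (auto simp: power_0_left)
  have \<gamma>0: "\<gamma> \<noteq> 0" using \<gamma>(1) by auto
  have e0: "e \<noteq> 0" using e(1) by auto
  have nz: "k z \<noteq> 0" "A z \<noteq> 0" "B z \<noteq> 0" if "norm z < 1" "z \<noteq> 0" for z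
    using \<gamma>(3)[OF that(1)] e(2)[OF that] \<gamma>0 e0 that n by (auto simp: power_0_left)
  define u where "u z = z * A z / B z" for z
  have un: "u z ^ n = \<gamma> / of_real e" if "norm z < 1" "z \<noteq> 0" for z
  proof -
    have "u z ^ n = z ^ n * (k z * A z ^ n) / (k z * B z ^ n)"
      using nz[OF that] by (simp add: u_def power_divide power_mult_distrib)
    then show ?thesis using that by (simp add: \<gamma>(3) e(2))
  qed
  \<comment> \<open>A continuous function with values among finitely many roots is constant on a
    connected set.\<close>
  have "u constant_on (ball 0 1 - {0})"
  proof (rule continuous_finite_range_constant)
    show "connected (ball (0::complex) 1 - {0})" by (intro connected_punctured_ball) auto
    show "continuous_on (ball 0 1 - {0}) u"
      unfolding u_def using nz ball_subset
      by (intro continuous_intros continuous_on_subset[OF holomorphic_on_imp_continuous_on[OF A_holomorphic]]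
          continuous_on_subset[OF holomorphic_on_imp_continuous_on[OF B_holomorphic]]) auto
    have "u ` (ball 0 1 - {0}) \<subseteq> {v. v ^ n = \<gamma> / of_real e}" using un by auto
    moreover have "finite {v. v ^ n = \<gamma> / of_real e}" using n by (intro finite_nth_roots) auto
    ultimately show "finite (u ` (ball 0 1 - {0}))" by (rule finite_subset)
  qed
  then obtain \<mu> where \<mu>: "\<And>z. norm z < 1 \<Longrightarrow> z \<noteq> 0 \<Longrightarrow> u z = \<mu>" by (auto simp: constant_on_def)
  have "\<mu> ^ n = \<gamma> / of_real e" using un[of "1/2"] \<mu>[of "1/2"] by simp
  then have "norm \<mu> ^ n = 1" using \<gamma>(1) e(1) by (metis norm_divide norm_power norm_of_real abs_1 abs_minus div_by_1)
  then have norm_\<mu>: "norm \<mu> = 1" using n power_eq_imp_eq_base[of "norm \<mu>" n 1] by simp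
  \<comment> \<open>Chosen so that \<open>\<kappa> * z\<close> becomes the quantity \<open>v\<close>
    of \<open>joukowski_B_identity\<close>.\<close>
  define \<kappa> where "\<kappa> = (cnj q)\<^sup>2 / \<mu>"
  have qq: "q * cnj q = 1" by (simp add: q_def cis_cnj cis_mult)
  have "q - cnj q = of_real (2 * sin \<alpha>) * \<i>" by (auto simp: q_def complex_eq_iff)
  then have q2: "(q - cnj q)\<^sup>2 = - of_real (4 * (sin \<alpha>)\<^sup>2)" by (simp add: power_mult_distrib)
  have "norm \<kappa> = 1" using norm_\<mu> by (simp add: \<kappa>_def norm_divide norm_power q_def)
  moreover have "F z = of_real e * cheb_complex n (- 1 - (\<kappa> * z + 1 / (\<kappa> * z) - 2) / of_real (2 * (sin \<alpha>)\<^sup>2))"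
    if z: "norm z < 1" "z \<noteq> 0" for z
  proof -
    have zE: "z \<notin> cis ` E" "z \<in> V" using z \<gamma>(2) by auto
    note xq = x_plus_nonzero[OF zE(1)]
    have xm: "x z - q \<noteq> 0" "x z - cnj q \<noteq> 0" using nz[OF z] by (auto simp: A_def B_def)
    have *: "(x z)\<^sup>2 - q\<^sup>2 = (x z - q) * (x z + q)" "(x z)\<^sup>2 - (cnj q)\<^sup>2 = (x z - cnj q) * (x z + cnj q)"
      by (simp_all add: power2_eq_square algebra_simps)
    have "z * ((x z)\<^sup>2 - (cnj q)\<^sup>2) / ((x z)\<^sup>2 - q\<^sup>2) = u z"
      unfolding * u_def A_def B_def using xq xm by (simp add: divide_simps power2_eq_square)
    then have "\<mu> = z * ((x z)\<^sup>2 - (cnj q)\<^sup>2) / ((x z)\<^sup>2 - q\<^sup>2)" using \<mu>[OF z] by simp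
    moreover have "(x z)\<^sup>2 - q\<^sup>2 \<noteq> 0" "(x z)\<^sup>2 - (cnj q)\<^sup>2 \<noteq> 0" unfolding * using xq xm by simp_all
    moreover have "z / (z * b / a) = a / b" if "a \<noteq> 0" "b \<noteq> 0" for a b using that z by simp
    ultimately have "z / \<mu> = ((x z)\<^sup>2 - q\<^sup>2) / ((x z)\<^sup>2 - (cnj q)\<^sup>2)" by (simp only:)
    then have "(cnj q)\<^sup>2 * (z / \<mu>) = (cnj q)\<^sup>2 * (((x z)\<^sup>2 - q\<^sup>2) / ((x z)\<^sup>2 - (cnj q)\<^sup>2))"
      by (simp only:)
    then have v: "\<kappa> * z = (cnj q)\<^sup>2 * ((x z)\<^sup>2 - q\<^sup>2) / ((x z)\<^sup>2 - (cnj q)\<^sup>2)"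
      by (simp add: \<kappa>_def)
    have M: "(B z + 1 / B z) / 2 = - 1 + 2 * (\<kappa> * z + 1 / (\<kappa> * z) - 2) / (q - cnj q)\<^sup>2"
      unfolding B_def using xq xm q2 sin by (intro joukowski_B_identity[OF qq _ _ v]) auto
    \<comment> \<open>The Joukowski root of \<open>F z\<close> is
      \<open>of_real e / B z ^ n\<close>; since \<open>e\<close> is a sign, it comes out of the sum
      of the root and its reciprocal.\<close>
    have "2 * F z = joukowski_inv (F z) + 1 / joukowski_inv (F z)"
      using k_eq(2)[OF zE(2) z(2)] by (simp add: joukowski_inv_sum)
    also have "joukowski_inv (F z) = of_real e / B z ^ n"
      using k_eq(1)[OF zE(2) z(2)] e(2)[OF z] z nz[OF z] by (simp add: field_simps)
    also have "of_real e / B z ^ n + 1 / (of_real e / B z ^ n) = of_real e * (B z ^ n + 1 / B z ^ n)"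
      using e(1) by (auto simp: algebra_simps)
    finally have "F z = of_real e * cheb_complex n ((B z + 1 / B z) / 2)"
      using nz[OF z] by (simp add: cheb_complex_joukowski mult.commute[of "F z" 2])
    moreover have "- 1 + 2 * w / - of_real (4 * (sin \<alpha>)\<^sup>2) = - 1 - w / of_real (2 * (sin \<alpha>)\<^sup>2)" for w :: complex
      using sin by (simp add: field_simps)
    ultimately show ?thesis unfolding M q2 by (simp only:)
  qed
  ultimately show thesis using that e(1) by blast
qed

text \<open>Both sides of the disc identity are continuous away from 0, so it persists on the
  circle; there, with \<open>\<kappa> = cis \<theta>\<close>, the expression in
  \<open>\<kappa> * z\<close> becomes a shifted cosine.\<close>

theorem extremal_circle:
  assumes eq: "2 * norm (p 0) * sin \<alpha> ^ (2 * n) = 1"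
  obtains e \<theta> where "e = 1 \<or> e = (- 1 :: real)"
    "\<And>t. F (cis t) = of_real (e * cheb_T n (- 1 + (1 - cos (t + \<theta>)) / (sin \<alpha>)\<^sup>2))"
proof -
  obtain e \<kappa> where e: "e = 1 \<or> e = (- 1 :: real)" and \<kappa>: "norm \<kappa> = 1" and eqn:
    "\<And>z. norm z < 1 \<Longrightarrow> z \<noteq> 0 \<Longrightarrow>
      F z = of_real e * cheb_complex n (- 1 - (\<kappa> * z + 1 / (\<kappa> * z) - 2) / of_real (2 * (sin \<alpha>)\<^sup>2))"
    using extremal_disc[OF eq] by blast
  have sin: "sin \<alpha> \<noteq> 0" using eq n by (auto simp: power_0_left)
  have \<kappa>0: "\<kappa> \<noteq> 0" using \<kappa> by auto
  define d where "d z = F z - of_real e * cheb_complex n (- 1 - (\<kappa> * z + 1 / (\<kappa> * z) - 2) / of_real (2 * (sin \<alpha>)\<^sup>2))" for z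
  have "continuous_on (- {0}) d" unfolding d_def F_def using \<kappa>0 sin
    by (intro continuous_intros p_continuous) auto
  then have cont: "isCont d z" if "z \<noteq> 0" for z
    using that by (simp add: continuous_on_eq_continuous_at open_Compl)
  have d0: "d w = 0" if "norm w = 1" for w
    by (rule continuous_constant_limit[OF cont circle_islimpt_ball[OF that]]) (use that eqn in \<open>auto simp: d_def\<close>)
  define \<theta> where "\<theta> = Arg2pi \<kappa>"
  have \<theta>: "\<kappa> = cis \<theta>" using \<kappa> Arg2pi_eq[of \<kappa>] by (simp add: cis_conv_exp \<theta>_def)
  have "F (cis t) = of_real (e * cheb_T n (- 1 + (1 - cos (t + \<theta>)) / (sin \<alpha>)\<^sup>2))" for t
  proof -
    have "\<kappa> * cis t = cis (t + \<theta>)" by (simp add: \<theta> cis_mult add.commute)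
    moreover have "cis s + 1 / cis s - 2 = of_real (2 * cos s - 2)" for s
      by (simp add: complex_eq_iff flip: inverse_eq_divide)
    ultimately have M: "- 1 - (\<kappa> * cis t + 1 / (\<kappa> * cis t) - 2) / of_real (2 * (sin \<alpha>)\<^sup>2) =
        of_real (- 1 - (2 * cos (t + \<theta>) - 2) / (2 * (sin \<alpha>)\<^sup>2))" by simp
    have "- 1 - (2 * cos (t + \<theta>) - 2) / (2 * (sin \<alpha>)\<^sup>2) = - 1 + (1 - cos (t + \<theta>)) / (sin \<alpha>)\<^sup>2"
      using sin by (simp add: field_simps)
    then show ?thesis
      using d0[OF norm_cis[of t]] unfolding d_def M
      by (simp only: cheb_complex_of_real right_minus_eq of_real_mult)
  qed
  then show thesis using that e by blast
qed

end

section \<open>Trigonometric polynomials\<close>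

text \<open>Closure properties under linear operations need be checked only on the basis functions;
  constants are multiples of the cosine with \<open>k = 0\<close>.\<close>

lemma trig_poly_induct [consumes 1, case_names cos sin add scale]:
  assumes f: "trig_poly m f"
    and cos: "\<And>k. k \<le> m \<Longrightarrow> Q (\<lambda>t. cos (real k * t))"
    and sin: "\<And>k. k \<le> m \<Longrightarrow> Q (\<lambda>t. sin (real k * t))"
    and add: "\<And>f g. Q f \<Longrightarrow> Q g \<Longrightarrow> Q (\<lambda>t. f t + g t)"
    and scale: "\<And>f r. Q f \<Longrightarrow> Q (\<lambda>t. r * f t)"
  shows "Q f"
proof -
  obtain a b where ab: "f = (\<lambda>t. a 0 / 2 + (\<Sum>k=1..m. a k * cos (real k * t) + b k * sin (real k * t)))"
    using f by (auto simp: trig_poly_def)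
  have const: "Q (\<lambda>t. c)" for c using scale[OF cos[of 0], of c] by simp
  have "Q (\<lambda>t. \<Sum>k\<in>K. a k * cos (real k * t) + b k * sin (real k * t))" if "finite K" "K \<subseteq> {..m}" for K
    using that
  proof (induction K rule: finite_induct)
    case empty
    show ?case using const[of 0] by simp
  next
    case (insert k K)
    then show ?case by (simp, intro add scale cos sin) auto
  qed
  from this[of "{1..m}"] show ?thesis unfolding ab by (intro add const) auto
qed

section \<open>Closure properties of trigonometric polynomials\<close>

lemma trig_poly_add:
  assumes "trig_poly m f" "trig_poly m g"
  shows "trig_poly m (\<lambda>t. f t + g t)"
proof -
  obtain a b c d where
    "\<And>t. f t = a 0 / 2 + (\<Sum>k=1..m. a k * cos (real k * t) + b k * sin (real k * t))"
    "\<And>t. g t = c 0 / 2 + (\<Sum>k=1..m. c k * cos (real k * t) + d k * sin (real k * t))"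
    using assms by (auto simp: trig_poly_def)
  then show ?thesis unfolding trig_poly_def
    by (intro exI[of _ "\<lambda>k. a k + c k"] exI[of _ "\<lambda>k. b k + d k"])
       (simp add: sum.distrib algebra_simps add_divide_distrib)
qed

lemma trig_poly_scale:
  assumes "trig_poly m f"
  shows "trig_poly m (\<lambda>t. r * f t)"
proof -
  obtain a b where "\<And>t. f t = a 0 / 2 + (\<Sum>k=1..m. a k * cos (real k * t) + b k * sin (real k * t))"
    using assms by (auto simp: trig_poly_def)
  then show ?thesis unfolding trig_poly_def
    by (intro exI[of _ "\<lambda>k. r * a k"] exI[of _ "\<lambda>k. r * b k"])
       (simp add: sum_distrib_left algebra_simps)
qed

lemma trig_poly_cos:
  assumes "k \<le> m"
  shows "trig_poly m (\<lambda>t. cos (real k * t))"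
  unfolding trig_poly_def
proof (intro exI allI)
  fix t :: real
  \<comment> \<open>The constant term is halved in the definition, hence the coefficient 2 for
    \<open>k = 0\<close>.\<close>
  let ?a = "\<lambda>j. if j = k then if k = 0 then 2 else 1 else (0::real)"
  have "(\<Sum>j=1..m. ?a j * cos (real j * t) + 0 * sin (real j * t)) = (\<Sum>j=1..m. if j = k then cos (real k * t) else 0)"
    by (intro sum.cong) auto
  then show "cos (real k * t) = ?a 0 / 2 + (\<Sum>j=1..m. ?a j * cos (real j * t) + (\<lambda>j. 0) j * sin (real j * t))"
    using assms by (auto simp: Suc_le_eq)
qed

lemma trig_poly_sin:
  assumes "k \<le> m"
  shows "trig_poly m (\<lambda>t. sin (real k * t))"
  unfolding trig_poly_def
proof (intro exI allI)
  fix t :: real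
  let ?b = "\<lambda>j. if j = k then 1 else (0::real)"
  have "(\<Sum>j=1..m. 0 * cos (real j * t) + ?b j * sin (real j * t)) = (\<Sum>j=1..m. if j = k then sin (real k * t) else 0)"
    by (intro sum.cong) auto
  then show "sin (real k * t) = (\<lambda>j. 0) 0 / 2 + (\<Sum>j=1..m. (\<lambda>j. 0) j * cos (real j * t) + ?b j * sin (real j * t))"
    using assms by (auto simp: Suc_le_eq)
qed

lemmas trig_poly_intros = trig_poly_add trig_poly_scale trig_poly_cos trig_poly_sin

lemma trig_poly_const: "trig_poly m (\<lambda>t. c)"
  using trig_poly_scale[OF trig_poly_cos[of 0 m], of c] by simp

lemma trig_poly_mono: "trig_poly m f \<Longrightarrow> m \<le> m' \<Longrightarrow> trig_poly m' f"
  by (induction rule: trig_poly_induct) (auto intro: trig_poly_intros)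

lemma trig_poly_shift: "trig_poly m f \<Longrightarrow> trig_poly m (\<lambda>t. f (t + c))"
proof (induction rule: trig_poly_induct)
  case (cos k)
  have "trig_poly m (\<lambda>t. cos (real k * c) * cos (real k * t) + (- sin (real k * c)) * sin (real k * t))"
    by (intro trig_poly_intros cos)
  then show ?case by (simp add: distrib_left cos_add mult.commute)
next
  case (sin k)
  have "trig_poly m (\<lambda>t. cos (real k * c) * sin (real k * t) + sin (real k * c) * cos (real k * t))"
    by (intro trig_poly_intros sin)
  then show ?case by (simp add: distrib_left sin_add mult.commute)
qed (auto intro: trig_poly_intros)

text \<open>The product-to-sum formulas raise the order by one; \<open>k = 0\<close> is treated
  apart because the formula refers to the frequency \<open>k - 1\<close>.\<close>

lemma trig_poly_mult_cos: "trig_poly m f \<Longrightarrow> trig_poly (Suc m) (\<lambda>t. cos t * f t)"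
proof (induction rule: trig_poly_induct)
  case (cos k)
  show ?case
  proof (cases k)
    case 0
    then show ?thesis using trig_poly_cos[of 1 "Suc m"] by simp
  next
    case (Suc j)
    have "cos t * cos (real k * t) = 1 / 2 * cos (real (Suc k) * t) + 1 / 2 * cos (real j * t)" for t
    proof -
      have e: "real k * t - t = real j * t" "real k * t + t = real (Suc k) * t"
        by (simp_all add: Suc algebra_simps)
      show ?thesis using cos_times_cos[of "real k * t" t] unfolding e by (simp add: field_simps)
    qed
    moreover have "trig_poly (Suc m) (\<lambda>t. 1 / 2 * cos (real (Suc k) * t) + 1 / 2 * cos (real j * t))"
      using cos Suc by (intro trig_poly_intros) auto
    ultimately show ?thesis by simp
  qed
next
  case (sin k)
  show ?case
  proof (cases k)
    case 0
    then show ?thesis using trig_poly_const[of "Suc m" 0] by simp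
  next
    case (Suc j)
    have "cos t * sin (real k * t) = 1 / 2 * sin (real (Suc k) * t) + 1 / 2 * sin (real j * t)" for t
    proof -
      have e: "real k * t - t = real j * t" "real k * t + t = real (Suc k) * t"
        by (simp_all add: Suc algebra_simps)
      show ?thesis using sin_times_cos[of "real k * t" t] unfolding e by (simp add: field_simps)
    qed
    moreover have "trig_poly (Suc m) (\<lambda>t. 1 / 2 * sin (real (Suc k) * t) + 1 / 2 * sin (real j * t))"
      using sin Suc by (intro trig_poly_intros) auto
    ultimately show ?thesis by simp
  qed
next
  case (add f g)
  then show ?case using trig_poly_add[OF add] by (simp add: algebra_simps)
next
  case (scale f r)
  then show ?case using trig_poly_scale[OF scale, of r] by (simp add: algebra_simps)
qed

lemma trig_poly_continuous: "trig_poly m f \<Longrightarrow> continuous_on S f"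
  by (induction rule: trig_poly_induct) (auto intro!: continuous_intros)

text \<open>For each frequency \<open>k < n\<close> the sum is geometric, and its ratio is a root of
  unity of order dividing \<open>2 * n\<close> and different from 1.\<close>

lemma trig_poly_alternating_sum:
  assumes n: "n \<ge> 1" and f: "trig_poly (n - 1) f"
  shows "(\<Sum>j<2*n. (-1) ^ j * f (pi * real j / real n)) = 0"
proof -
  have *: "(\<Sum>j<2*n. (-1) ^ j * cis (real k * (pi * real j / real n))) = 0" if k: "k \<le> n - 1" for k
  proof -
    define s where "s = pi * real k / real n"
    have s: "0 \<le> s" "s < pi" using k n by (auto simp: s_def field_simps)
    have "(-1) ^ j * cis (real k * (pi * real j / real n)) = cis (pi + s) ^ j" for j
    proof -
      have "cis (pi + s) ^ j = (-1) ^ j * cis (real j * s)"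
        by (simp only: cis_mult[symmetric] cis_pi power_mult_distrib) (simp only: Complex.DeMoivre)
      moreover have "real j * s = real k * (pi * real j / real n)" by (simp add: s_def)
      ultimately show ?thesis by (simp only:)
    qed
    moreover have "cis (pi + s) \<noteq> 1"
    proof
      assume "cis (pi + s) = 1"
      then have "cos s = - 1" by (auto simp: complex_eq_iff)
      moreover have "cos pi < cos s" using s by (intro cos_monotone_0_pi) auto
      ultimately show False by simp
    qed
    moreover have "cis (pi + s) ^ (2 * n) = 1"
    proof -
      have "real (2 * n) * (pi + s) = 2 * pi * real (n + k)"
        using n by (simp add: s_def distrib_left)
      then have "cis (pi + s) ^ (2 * n) = cis (2 * pi * real (n + k))"
        by (simp only: Complex.DeMoivre)
      then show ?thesis by (metis cis_multiple_2pi Ints_of_nat)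
    qed
    ultimately show ?thesis by (simp add: geometric_sum)
  qed
  have "(\<Sum>j<2*n. (-1) ^ j * cos (real k * (pi * real j / real n))) = 0 \<and>
        (\<Sum>j<2*n. (-1) ^ j * sin (real k * (pi * real j / real n))) = 0" if k: "k \<le> n - 1" for k
  proof -
    have r: "(-1) ^ j * z = of_real ((-1) ^ j) * z" for j and z :: complex by simp
    have "Re (\<Sum>j<2*n. (-1) ^ j * cis (real k * (pi * real j / real n))) = 0"
         "Im (\<Sum>j<2*n. (-1) ^ j * cis (real k * (pi * real j / real n))) = 0" using *[OF k] by simp_all
    then show ?thesis unfolding r Re_sum Im_sum by (simp del: of_real_power)
  qed
  note cs = this
  show ?thesis using f
  proof (induction rule: trig_poly_induct)
    case (add f g)
    then show ?case by (simp add: distrib_left sum.distrib)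
  next
    case (scale f r)
    have "(\<Sum>j<2*n. (-1) ^ j * (r * f (pi * real j / real n))) = r * (\<Sum>j<2*n. (-1) ^ j * f (pi * real j / real n))"
      by (simp add: sum_distrib_left mult_ac)
    then show ?case using scale by simp
  qed (use cs in auto)
qed

text \<open>At these nodes \<open>cos (real n * t)\<close> alternates between 1 and -1, so the sum
  isolates the leading coefficient.\<close>

lemma Fny_alternating_sum:
  assumes n: "n \<ge> 1" and f: "f \<in> Fny n y"
  shows "(\<Sum>j<2*n. (-1) ^ j * f (pi * real j / real n)) = 2 * real n * y"
proof -
  obtain g where g: "trig_poly (n - 1) g" "f = (\<lambda>t. y * cos (real n * t) + g t)"
    using f by (auto simp: Fny_def)
  have "cos (real n * (pi * real j / real n)) = (-1) ^ j" for j
    using n cos_npi[of j] by (simp add: mult.commute)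
  then have "(\<Sum>j<2*n. (-1) ^ j * f (pi * real j / real n)) =
      (\<Sum>j<2*n. y) + (\<Sum>j<2*n. (-1) ^ j * g (pi * real j / real n))"
    unfolding g(2) sum.distrib[symmetric] by (intro sum.cong) (simp_all add: algebra_simps flip: power_add mult_2)
  then show ?thesis using trig_poly_alternating_sum[OF n g(1)] by simp
qed

text \<open>The data of \<open>self_reciprocal\<close> as a predicate that is linear in the pair of
  \<open>f\<close> and \<open>c\<close>. The value \<open>c\<close> at 0 is the coefficient of
  \<open>cis (- n * t)\<close> in \<open>f\<close>, so only the leading terms contribute.\<close>

definition reciprocal_lift :: "nat \<Rightarrow> (real \<Rightarrow> real) \<Rightarrow> complex \<Rightarrow> bool" where
  "reciprocal_lift n f c \<longleftrightarrow> (\<exists>p. p holomorphic_on UNIV \<and> p 0 = c \<and>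
     (\<forall>z. z \<noteq> 0 \<longrightarrow> p (1 / cnj z) = cnj (p z / z ^ (2 * n))) \<and>
     (\<forall>t. p (cis t) = cis t ^ n * of_real (f t)))"

lemma reciprocal_lift_add:
  assumes "reciprocal_lift n f c" "reciprocal_lift n g d"
  shows "reciprocal_lift n (\<lambda>t. f t + g t) (c + d)"
proof -
  obtain p q where
    "p holomorphic_on UNIV" "p 0 = c" "\<And>z. z \<noteq> 0 \<Longrightarrow> p (1 / cnj z) = cnj (p z / z ^ (2 * n))"
    "\<And>t. p (cis t) = cis t ^ n * of_real (f t)"
    "q holomorphic_on UNIV" "q 0 = d" "\<And>z. z \<noteq> 0 \<Longrightarrow> q (1 / cnj z) = cnj (q z / z ^ (2 * n))"
    "\<And>t. q (cis t) = cis t ^ n * of_real (g t)"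
    using assms unfolding reciprocal_lift_def by blast
  then show ?thesis unfolding reciprocal_lift_def
    by (intro exI[of _ "\<lambda>z. p z + q z"]) (auto intro!: holomorphic_intros simp: add_divide_distrib distrib_left)
qed

lemma reciprocal_lift_scale:
  assumes "reciprocal_lift n f c"
  shows "reciprocal_lift n (\<lambda>t. r * f t) (of_real r * c)"
proof -
  obtain p where
    "p holomorphic_on UNIV" "p 0 = c" "\<And>z. z \<noteq> 0 \<Longrightarrow> p (1 / cnj z) = cnj (p z / z ^ (2 * n))"
    "\<And>t. p (cis t) = cis t ^ n * of_real (f t)"
    using assms unfolding reciprocal_lift_def by blast
  then show ?thesis unfolding reciprocal_lift_def
    by (intro exI[of _ "\<lambda>z. of_real r * p z"]) (auto intro!: holomorphic_intros)
qed

text \<open>The lift is \<open>z ^ (n - k) * (z ^ (2 * k) + 1) / 2\<close>, which at 0 survives only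
  for \<open>k = n\<close>.\<close>

lemma reciprocal_lift_cos:
  assumes "k \<le> n" "n \<ge> 1"
  shows "reciprocal_lift n (\<lambda>t. cos (real k * t)) (if k = n then 1 / 2 else 0)"
proof -
  obtain m where m: "n = m + k" using assms(1) by (metis le_add_diff_inverse2)
  define p :: "complex \<Rightarrow> complex" where "p z = z ^ m * (z ^ (2 * k) + 1) / 2" for z
  have "p holomorphic_on UNIV" unfolding p_def by (intro holomorphic_intros) auto
  moreover have "p 0 = (if k = n then 1 / 2 else 0)" using assms m by (auto simp: p_def power_0_left)
  moreover have "p (1 / cnj z) = cnj (p z / z ^ (2 * n))" if "z \<noteq> 0" for z
  proof -
    define a b where "a = cnj z ^ m" and "b = cnj z ^ (2 * k)"
    have nz: "a \<noteq> 0" "b \<noteq> 0" using that by (auto simp: a_def b_def)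
    have "2 * n = m + m + 2 * k" by (simp add: m)
    then have "cnj (p z / z ^ (2 * n)) = a * (b + 1) / (2) / (a * a * b)"
      by (simp only: p_def power_add a_def b_def) simp
    moreover have "p (1 / cnj z) = 1 / a * (1 / b + 1) / (2)"
      by (simp add: p_def a_def b_def power_one_over)
    moreover have "1 / a * (1 / b + 1) / (2) = a * (b + 1) / (2) / (a * a * b)"
      using nz by (simp add: field_simps)
    ultimately show ?thesis by (simp only:)
  qed
  moreover have "p (cis t) = cis t ^ n * of_real (cos (real k * t))" for t
  proof -
    have *: "cis t ^ (2 * k) + 1 = cis t ^ k * of_real (2 * cos (real k * t))"
    proof -
      have "of_real (2 * cos (real k * t)) = cis (real k * t) + cis (- (real k * t))"
        by (simp add: complex_eq_iff)
      then show ?thesis by (simp only: Complex.DeMoivre distrib_left cis_mult) (simp add: algebra_simps)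
    qed
    show ?thesis unfolding p_def * by (simp add: m power_add)
  qed
  ultimately show ?thesis unfolding reciprocal_lift_def by blast
qed

lemma reciprocal_lift_sin:
  assumes "k < n"
  shows "reciprocal_lift n (\<lambda>t. sin (real k * t)) 0"
proof -
  obtain m where m: "n = m + k" "m > 0" using assms by (metis add.commute less_imp_add_positive)
  define p :: "complex \<Rightarrow> complex" where "p z = z ^ m * (z ^ (2 * k) - 1) / (2 * \<i>)" for z
  have "p holomorphic_on UNIV" unfolding p_def by (intro holomorphic_intros) auto
  moreover have "p 0 = 0" using m by (auto simp: p_def power_0_left)
  moreover have "p (1 / cnj z) = cnj (p z / z ^ (2 * n))" if "z \<noteq> 0" for z
  proof -
    define a b where "a = cnj z ^ m" and "b = cnj z ^ (2 * k)"
    have nz: "a \<noteq> 0" "b \<noteq> 0" using that by (auto simp: a_def b_def)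
    have "2 * n = m + m + 2 * k" by (simp add: m)
    then have "cnj (p z / z ^ (2 * n)) = a * (b - 1) / (- (2 * \<i>)) / (a * a * b)"
      by (simp only: p_def power_add a_def b_def) simp
    moreover have "p (1 / cnj z) = 1 / a * (1 / b - 1) / (2 * \<i>)"
      by (simp add: p_def a_def b_def power_one_over)
    moreover have "1 / a * (1 / b - 1) / (2 * \<i>) = a * (b - 1) / (- (2 * \<i>)) / (a * a * b)"
      using nz by (simp add: field_simps)
    ultimately show ?thesis by (simp only:)
  qed
  moreover have "p (cis t) = cis t ^ n * of_real (sin (real k * t))" for t
  proof -
    have *: "cis t ^ (2 * k) - 1 = cis t ^ k * (of_real (sin (real k * t)) * (2 * \<i>))"
    proof -
      have "of_real (sin (real k * t)) * (2 * \<i>) = cis (real k * t) - cis (- (real k * t))"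
        by (simp add: complex_eq_iff)
      then show ?thesis by (simp only: Complex.DeMoivre right_diff_distrib cis_mult) (simp add: algebra_simps)
    qed
    show ?thesis unfolding p_def * by (simp add: m power_add) (simp add: algebra_simps)
  qed
  ultimately show ?thesis unfolding reciprocal_lift_def by blast
qed

lemma trig_poly_reciprocal_lift:
  assumes n: "n \<ge> 1" and f: "trig_poly (n - 1) f"
  shows "reciprocal_lift n f 0"
  using f
proof (induction rule: trig_poly_induct)
  case (cos k)
  then have "k < n" using n by linarith
  then show ?case using reciprocal_lift_cos[of k n] by simp
next
  case (sin k)
  then show ?case using reciprocal_lift_sin[of k n] n by linarith
next
  case (add f g)
  then show ?case using reciprocal_lift_add by force
next
  case (scale f r)
  then show ?case using reciprocal_lift_scale by force
qed

lemma Fny_reciprocal_lift: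
  assumes n: "n \<ge> 1" and f: "f \<in> Fny n y"
  shows "reciprocal_lift n f (of_real y / 2)"
proof -
  obtain g where g: "trig_poly (n - 1) g" "f = (\<lambda>t. y * cos (real n * t) + g t)"
    using f by (auto simp: Fny_def)
  have "reciprocal_lift n (\<lambda>t. y * cos (real n * t)) (of_real y * (1 / 2))"
    using reciprocal_lift_scale[OF reciprocal_lift_cos[of n n]] n by simp
  from reciprocal_lift_add[OF this trig_poly_reciprocal_lift[OF n g(1)]] show ?thesis
    by (simp add: g(2))
qed

lemma Fny_continuous:
  assumes "f \<in> Fny n y"
  shows "continuous_on S f"
proof -
  obtain g where g: "trig_poly (n - 1) g" "f = (\<lambda>t. y * cos (real n * t) + g t)"
    using assms by (auto simp: Fny_def)
  show ?thesis unfolding g(2) by (intro continuous_intros trig_poly_continuous[OF g(1)])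
qed

text \<open>In the recurrence, \<open>2 * cos t * cos (real (Suc j) * t)\<close> contributes the new
  leading cosine with coefficient 1, so each step multiplies the leading coefficient by exactly
  \<open>a\<close>.\<close>

lemma cheb_T_trig_poly:
  "\<exists>g. trig_poly m g \<and> (\<forall>t. cheb_T (Suc m) (a * cos t + b) = a ^ Suc m * cos (real (Suc m) * t) + g t)"
proof (induction m rule: less_induct)
  case (less m)
  consider "m = 0" | j where "m = Suc j" by (cases m) auto
  then show ?case
  proof cases
    case 1
    then show ?thesis using trig_poly_const[of 0 b] by (intro exI[of _ "\<lambda>t. b"]) simp
  next
    case 2
    obtain g where g: "trig_poly j g" "\<And>t. cheb_T (Suc j) (a * cos t + b) = a ^ Suc j * cos (real (Suc j) * t) + g t"
      using less[of j] 2 by auto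
    have h: "trig_poly (Suc j) (\<lambda>t. cheb_T j (a * cos t + b))"
    proof (cases j)
      case 0
      then show ?thesis by (simp add: trig_poly_const)
    next
      case (Suc i)
      obtain g' where g': "trig_poly i g'" "\<And>t. cheb_T (Suc i) (a * cos t + b) = a ^ Suc i * cos (real (Suc i) * t) + g' t"
        using less[of i] 2 Suc by auto
      show ?thesis unfolding Suc g'(2)
        by (intro trig_poly_intros trig_poly_mono[OF g'(1)]) auto
    qed
    \<comment> \<open>Everything in the recurrence apart from the leading cosine; each summand has
      order at most \<open>m\<close>.\<close>
    define G where "G t = a ^ Suc m * cos (real j * t) + 2 * b * a ^ Suc j * cos (real (Suc j) * t)
        + 2 * a * (cos t * g t) + 2 * b * g t + (- 1) * cheb_T j (a * cos t + b)" for t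
    have "trig_poly m G" unfolding G_def 2
      by (intro trig_poly_intros h trig_poly_mult_cos g trig_poly_mono[OF g(1)]) auto
    moreover have "cheb_T (Suc m) (a * cos t + b) = a ^ Suc m * cos (real (Suc m) * t) + G t" for t
    proof -
      have "2 * (cos t * cos (real (Suc j) * t)) = cos (real (Suc m) * t) + cos (real j * t)"
      proof -
        have e: "real (Suc j) * t - t = real j * t" "real (Suc j) * t + t = real (Suc m) * t"
          by (simp_all add: 2 algebra_simps)
        show ?thesis using cos_times_cos[of "real (Suc j) * t" t] unfolding e by (simp add: mult.commute)
      qed
      then have *: "2 * (a * cos t) * (a ^ Suc j * cos (real (Suc j) * t)) = a ^ Suc m * (cos (real (Suc m) * t) + cos (real j * t))"
        by (simp add: 2 mult_ac)
      have "2 * (u + b) * (w + v) - c = 2 * u * w + (2 * u * v + 2 * b * w + 2 * b * v - c)" for u v w c :: real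
        by (simp add: algebra_simps)
      then have "cheb_T (Suc m) (a * cos t + b) = 2 * (a * cos t) * (a ^ Suc j * cos (real (Suc j) * t)) +
          (2 * (a * cos t) * g t + 2 * b * (a ^ Suc j * cos (real (Suc j) * t)) + 2 * b * g t - cheb_T j (a * cos t + b))"
        by (simp only: 2 cheb_T.simps g(2))
      then show ?thesis unfolding * G_def by (simp add: distrib_left mult.assoc)
    qed
    ultimately show ?thesis by blast
  qed
qed

lemma cheb_T_cos: "cheb_T m (cos b) = cos (real m * b)"
proof (induction m rule: induct_nat_012)
  case (ge2 m)
  have e: "real (Suc m) * b - b = real m * b" "real (Suc m) * b + b = real (Suc (Suc m)) * b"
    by (simp_all add: algebra_simps)
  show ?case using cos_times_cos[of "real (Suc m) * b" b] unfolding e cheb_T.simps ge2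
    by (simp add: algebra_simps)
qed auto

lemma cheb_T_minus: "cheb_T m (- u) = (- 1) ^ m * cheb_T m u"
  by (induction m u rule: cheb_T.induct) (auto simp: algebra_simps)

section \<open>Polynomials deviating least from zero in measure\<close>

lemma measurable_level_set:
  assumes "continuous_on UNIV (f :: real \<Rightarrow> real)"
  shows "{t \<in> {a..<b}. \<bar>f t\<bar> \<ge> c} \<in> sets lborel"
proof -
  have "closed {t. c \<le> \<bar>f t\<bar>}"
    using assms by (intro closed_Collect_le continuous_intros)
  then have "{t. c \<le> \<bar>f t\<bar>} \<in> sets borel" by (rule borel_closed)
  moreover have "{t \<in> {a..<b}. \<bar>f t\<bar> \<ge> c} = {a..<b} \<inter> {t. c \<le> \<bar>f t\<bar>}" by auto
  ultimately show ?thesis by simp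
qed

text \<open>If \<open>f\<close> were bounded by 1 at all nodes, its alternating sum could not reach
  \<open>2 * n * y\<close>. So \<open>f\<close> exceeds 1 in modulus at a node and, by continuity,
  on an interval.\<close>

lemma Fny_small_set_measure_less:
  assumes n: "n \<ge> 1" and y: "y > 1" and f: "f \<in> Fny n y"
  shows "measure lborel {t \<in> {0..2*pi}. \<bar>f t\<bar> \<le> 1} < 2 * pi"
proof -
  have "\<exists>j<2*n. \<bar>f (pi * real j / real n)\<bar> > 1"
  proof (rule ccontr)
    assume "\<not> ?thesis"
    then have "(-1) ^ j * f (pi * real j / real n) \<le> 1" if "j < 2 * n" for j
    proof -
      have "\<bar>f (pi * real j / real n)\<bar> \<le> 1" using \<open>\<not> _\<close> that by (meson linorder_not_less)
      then show ?thesis by (cases "even j") auto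
    qed
    then have "(\<Sum>j<2*n. (-1) ^ j * f (pi * real j / real n)) \<le> (\<Sum>j<2*n. 1)"
      by (intro sum_mono) auto
    then show False using Fny_alternating_sum[OF n f] n y by simp
  qed
  then obtain j where j: "j < 2 * n" "\<bar>f (pi * real j / real n)\<bar> > 1" by blast
  define s where "s = pi * real j / real n"
  have s: "0 \<le> s" "s < 2 * pi" using j n by (auto simp: s_def field_simps simp flip: of_nat_mult of_nat_less_iff)
  have "isCont f s" using Fny_continuous[OF f, of UNIV] by (simp add: continuous_on_eq_continuous_at)
  then have "((\<lambda>t. \<bar>f t\<bar>) \<longlongrightarrow> \<bar>f s\<bar>) (at s)" by (intro tendsto_rabs) (simp add: isCont_def)
  then have "eventually (\<lambda>t. \<bar>f t\<bar> > 1) (at s)" using j(2) by (intro order_tendstoD(1)) (simp_all add: s_def)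
  then obtain d where d: "d > 0" "\<And>t. t \<noteq> s \<Longrightarrow> \<bar>t - s\<bar> < d \<Longrightarrow> \<bar>f t\<bar> > 1"
    unfolding eventually_at by (auto simp: dist_real_def)
  \<comment> \<open>Truncation keeps the interval to the right of \<open>s\<close> inside the
    period.\<close>
  define r where "r = min d (2 * pi - s)"
  have r: "r > 0" "r \<le> d" "s + r \<le> 2 * pi" using d(1) s by (auto simp: r_def)
  have "measure lborel {t \<in> {0..2*pi}. \<bar>f t\<bar> \<le> 1} \<le> measure lborel ({0..2*pi} - {s<..<s + r})"
  proof (rule measure_mono_fmeasurable)
    show "{t \<in> {0..2*pi}. \<bar>f t\<bar> \<le> 1} \<subseteq> {0..2*pi} - {s<..<s + r}"
      using d(2) r(2) by (force simp: not_le)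
    have "closed {t. \<bar>f t\<bar> \<le> 1}" using Fny_continuous[OF f] by (intro closed_Collect_le continuous_intros)
    then have "{0..2*pi} \<inter> {t. \<bar>f t\<bar> \<le> 1} \<in> sets borel" by (intro borel_closed closed_Int) auto
    then show "{t \<in> {0..2*pi}. \<bar>f t\<bar> \<le> 1} \<in> sets lborel" by (simp add: Int_def)
    show "{0..2*pi} - {s<..<s + r} \<in> fmeasurable lborel"
      by (rule fmeasurableI2[of "{0..2*pi}"]) (auto intro: fmeasurable_compact)
  qed
  also have "\<dots> = 2 * pi - r"
    using r s by (subst measure_Diff) auto
  finally show ?thesis using r(1) by simp
qed

text \<open>The two sets cover the period; only an inequality is claimed, because points where the
  modulus of \<open>f\<close> is 1 are counted twice.\<close>

lemma sum_measure_level_sets_ge: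
  assumes "continuous_on UNIV f"
  shows "2 * pi \<le> mu f + measure lborel {t \<in> {0..2*pi}. \<bar>f t\<bar> \<le> 1}"
proof -
  have "closed {t. \<bar>f t\<bar> \<le> 1}" using assms by (intro closed_Collect_le continuous_intros)
  then have b: "{0..2*pi} \<inter> {t. \<bar>f t\<bar> \<le> 1} \<in> sets borel" by (intro borel_closed closed_Int) auto
  let ?A = "{t \<in> {0..<2*pi}. \<bar>f t\<bar> \<ge> 1}" and ?B = "{t \<in> {0..2*pi}. \<bar>f t\<bar> \<le> 1}"
  have A: "?A \<in> sets lborel" by (rule measurable_level_set[OF assms])
  have B: "?B \<in> sets lborel" using b by (simp add: Int_def)
  have "2 * pi = measure lborel {0..<2*pi}" by simp
  also have "\<dots> \<le> measure lborel (?A \<union> ?B)"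
  proof (rule measure_mono_fmeasurable)
    show "{0..<2*pi} \<subseteq> ?A \<union> ?B"
    proof
      fix t assume "t \<in> {0..<2*pi}"
      then show "t \<in> ?A \<union> ?B" by (cases "\<bar>f t\<bar> \<le> 1") simp_all
    qed
    show "?A \<union> ?B \<in> fmeasurable lborel"
    proof (rule fmeasurableI2)
      show "{0..2*pi} \<in> fmeasurable lborel" by (simp add: fmeasurable_compact)
      show "?A \<union> ?B \<in> sets lborel" using A B by (rule sets.Un)
    qed auto
  qed simp
  also have "\<dots> \<le> measure lborel ?A + measure lborel ?B"
    using A B by (rule measure_Un_le)
  finally show ?thesis by (simp add: mu_def)
qed

text \<open>The value of \<open>sin \<alpha>\<close> at which
  \<open>y * sin \<alpha> ^ (2 * n)\<close> reaches 1.\<close>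

definition critical_sine :: "nat \<Rightarrow> real \<Rightarrow> real" where
  "critical_sine n y = 1 / y powr (1 / (2 * real n))"

lemma critical_sine:
  assumes n: "n \<ge> 1" and y: "y > 1"
  shows "0 < critical_sine n y" "critical_sine n y < 1"
    "critical_sine n y ^ (2 * n) = 1 / y" "(critical_sine n y)\<^sup>2 = 1 / y powr (1 / real n)"
proof -
  have "y powr (1 / (2 * real n)) > 1" using n y by (intro gr_one_powr) auto
  then show "0 < critical_sine n y" "critical_sine n y < 1" by (auto simp: critical_sine_def divide_less_eq)
  have "(y powr (1 / (2 * real n))) ^ (2 * n) = y"
    using n y by (subst powr_realpow[symmetric]) (simp_all add: powr_powr)
  then show "critical_sine n y ^ (2 * n) = 1 / y" by (simp add: critical_sine_def power_divide)
  have "(y powr (1 / (2 * real n)))\<^sup>2 = y powr (1 / real n)"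
    using n y by (subst powr_realpow[symmetric]) (simp_all add: powr_powr)
  then show "(critical_sine n y)\<^sup>2 = 1 / y powr (1 / real n)" by (simp add: critical_sine_def power_divide)
qed

lemma leading_coefficient_nth_root:
  assumes "n \<ge> 1" "y > 1"
  shows "(y powr (1 / real n)) ^ n = y"
  using assms by (subst powr_realpow[symmetric]) (simp_all add: powr_powr)

text \<open>The leading coefficient bound for the lift of \<open>f\<close>, with
  \<open>\<alpha>\<close> a quarter of the measure, solved for the measure. In the case of equality
  the inverse square of the sine is \<open>y powr (1 / real n)\<close>.\<close>

lemma Fny_measure_bound:
  assumes n: "n \<ge> 1" and y: "y > 1" and f: "f \<in> Fny n y"
  defines "m \<equiv> measure lborel {t \<in> {0..2*pi}. \<bar>f t\<bar> \<le> 1}"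
  shows "m \<le> 4 * arcsin (critical_sine n y)"
    and "m = 4 * arcsin (critical_sine n y) \<Longrightarrow> \<exists>e \<theta>. (e = 1 \<or> e = - 1) \<and>
      f = (\<lambda>t. e * cheb_T n (y powr (1 / real n) * cos (t + \<theta>) - y powr (1 / real n) + 1))"
proof -
  note cs = critical_sine[OF n y]
  obtain p where p: "p holomorphic_on UNIV" "p 0 = of_real y / 2"
    "\<And>z. z \<noteq> 0 \<Longrightarrow> p (1 / cnj z) = cnj (p z / z ^ (2 * n))"
    "\<And>t. p (cis t) = cis t ^ n * of_real (f t)"
    using Fny_reciprocal_lift[OF n f] unfolding reciprocal_lift_def by blast
  have E: "{t \<in> {0..2*pi}. norm (p (cis t)) \<le> 1} = {t \<in> {0..2*pi}. \<bar>f t\<bar> \<le> 1}"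
    by (simp add: p(4) norm_mult norm_power)
  interpret S: self_reciprocal p n "{t \<in> {0..2*pi}. norm (p (cis t)) \<le> 1}"
  proof unfold_locales
    show "n \<ge> 1" "p holomorphic_on UNIV" by fact+
    show "p 0 \<noteq> 0" using y unfolding p(2) by simp
    show "p (1 / cnj z) = cnj (p z / z ^ (2 * n))" if "z \<noteq> 0" for z by (rule p(3)[OF that])
    show "measure lborel {t \<in> {0..2*pi}. norm (p (cis t)) \<le> 1} < 2 * pi"
      unfolding E by (rule Fny_small_set_measure_less[OF n y f])
  qed simp_all
  have \<alpha>: "S.\<alpha> = m / 4" unfolding S.\<alpha>_def m_def by (simp only: E)
  have \<alpha>b: "0 \<le> S.\<alpha>" "S.\<alpha> < pi / 2" by (rule S.alpha_bounds)+
  have lead: "2 * norm (p 0) = y" using y by (simp add: p(2) norm_divide)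
  have "y * sin S.\<alpha> ^ (2 * n) \<le> 1" using S.leading_coefficient_bound lead by simp
  then have "sin S.\<alpha> ^ (2 * n) \<le> critical_sine n y ^ (2 * n)" unfolding cs(3) using y by (simp add: field_simps)
  then have "sin S.\<alpha> \<le> critical_sine n y"
    using n cs(1) \<alpha>b by (subst (asm) power_mono_iff) (auto intro!: sin_ge_zero)
  then have "arcsin (sin S.\<alpha>) \<le> arcsin (critical_sine n y)"
    using cs(1,2) by (intro arcsin_le_arcsin) auto
  then show "m \<le> 4 * arcsin (critical_sine n y)" using \<alpha>b by (simp add: arcsin_sin \<alpha>)
  assume "m = 4 * arcsin (critical_sine n y)"
  then have sin: "sin S.\<alpha> = critical_sine n y" using cs(1,2) by (simp add: \<alpha>)
  have "2 * norm (p 0) * sin S.\<alpha> ^ (2 * n) = 1" using y by (simp add: lead sin cs(3))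
  then obtain e \<theta> where e: "e = 1 \<or> e = (- 1 :: real)" and
    F: "\<And>t. S.F (cis t) = of_real (e * cheb_T n (- 1 + (1 - cos (t + \<theta>)) / (sin S.\<alpha>)\<^sup>2))"
    using S.extremal_circle by blast
  define Y where "Y = y powr (1 / real n)"
  have "f t = e * (-1) ^ n * cheb_T n (Y * cos (t + \<theta>) - Y + 1)" for t
  proof -
    have "S.F (cis t) = of_real (f t)" by (simp add: S.F_def p(4))
    then have "f t = e * cheb_T n (- 1 + (1 - cos (t + \<theta>)) / (sin S.\<alpha>)\<^sup>2)" by (simp only: F of_real_eq_iff)
    \<comment> \<open>The argument is the negative of the desired one; parity of the Chebyshev
      polynomial turns this into a sign that joins \<open>e\<close>.\<close>
    also have "- 1 + (1 - cos (t + \<theta>)) / (sin S.\<alpha>)\<^sup>2 = - (Y * cos (t + \<theta>) - Y + 1)"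
      by (simp add: sin cs(4) Y_def algebra_simps)
    finally show ?thesis by (simp only: cheb_T_minus mult.assoc)
  qed
  moreover have "e * (-1) ^ n = 1 \<or> e * (-1) ^ n = - 1" using e by (cases "even n") auto
  ultimately show "\<exists>e \<theta>. (e = 1 \<or> e = - 1) \<and>
      f = (\<lambda>t. e * cheb_T n (y powr (1 / real n) * cos (t + \<theta>) - y powr (1 / real n) + 1))"
    unfolding Y_def by blast
qed

text \<open>Shifting by \<open>pi * k / n\<close> multiplies the leading cosine by
  \<open>(-1) ^ k\<close>, which cancels the sign in front.\<close>

lemma f_nk_in_Fny:
  assumes n: "n \<ge> 1" and y: "y > 1"
  shows "f_nk n y k \<in> Fny n y"
proof -
  define Y where "Y = y powr (1 / real n)"
  obtain m where m: "n = Suc m" using n by (cases n) auto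
  obtain g where g: "trig_poly m g" "\<And>t. cheb_T (Suc m) (Y * cos t + (1 - Y)) = Y ^ Suc m * cos (real (Suc m) * t) + g t"
    using cheb_T_trig_poly by blast
  have Yn: "Y ^ Suc m = y" using leading_coefficient_nth_root[OF n y] by (simp add: Y_def m)
  define h where "h t = (-1) ^ k * g (t + - (pi * real k / real n))" for t
  have "trig_poly m h"
    unfolding h_def by (intro trig_poly_scale trig_poly_shift g(1))
  then have "trig_poly (n - 1) h" by (simp add: m)
  moreover have "f_nk n y k t = y * cos (real n * t) + h t" for t
  proof -
    have "cos (real n * (t - pi * real k / real n)) = cos (real n * t - real k * pi)"
      using n by (simp add: right_diff_distrib mult.commute)
    also have "\<dots> = cos (real n * t) * (-1) ^ k" by (simp add: cos_diff)
    finally have c: "cos (real n * (t - pi * real k / real n)) = cos (real n * t) * (-1) ^ k" .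
    have "f_nk n y k t = (-1) ^ k * cheb_T (Suc m) (Y * cos (t - pi * real k / real n) + (1 - Y))"
      by (simp add: f_nk_def Y_def m algebra_simps)
    also have "\<dots> = (-1) ^ k * (y * (cos (real n * t) * (-1) ^ k) + g (t - pi * real k / real n))"
      unfolding g(2) Yn c[symmetric] by (simp only: m)
    also have "\<dots> = ((-1) ^ k * (-1) ^ k) * (y * cos (real n * t)) + h t"
      by (simp add: h_def algebra_simps)
    also have "(-1 :: real) ^ k * (-1) ^ k = 1" by (simp flip: power_mult_distrib)
    finally show ?thesis by simp
  qed
  ultimately show ?thesis unfolding Fny_def by blast
qed

lemma cos_le_imp_distance:
  assumes \<delta>: "0 < \<delta>" "\<delta> < pi" and w: "\<bar>w\<bar> < 2 * pi" and c: "cos w \<le> cos \<delta>"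
  shows "\<delta> \<le> \<bar>w\<bar>" "\<bar>w\<bar> \<le> 2 * pi - \<delta>"
proof -
  have c': "cos \<bar>w\<bar> \<le> cos \<delta>" using c by simp
  show "\<delta> \<le> \<bar>w\<bar>"
  proof (rule ccontr)
    assume "\<not> ?thesis"
    then have "cos \<delta> < cos \<bar>w\<bar>" using \<delta> by (intro cos_monotone_0_pi) auto
    then show False using c' by simp
  qed
  show "\<bar>w\<bar> \<le> 2 * pi - \<delta>"
  proof (rule ccontr)
    assume "\<not> ?thesis"
    then have "cos \<delta> < cos (2 * pi - \<bar>w\<bar>)" using \<delta> w by (intro cos_monotone_0_pi) auto
    then show False using c' by (simp add: cos_diff)
  qed
qed

lemma countable_cos_eq: "countable {t. cos (t - \<phi>) = (v::real)}"
proof (cases "\<exists>t0. cos (t0 - \<phi>) = v")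
  case True
  then obtain t0 where t0: "cos (t0 - \<phi>) = v" by blast
  have "{t. cos (t - \<phi>) = v} \<subseteq> range (\<lambda>i::int. t0 + 2 * of_int i * pi) \<union> range (\<lambda>i::int. 2 * \<phi> - t0 + 2 * of_int i * pi)"
  proof
    fix t assume "t \<in> {t. cos (t - \<phi>) = v}"
    then have "cos (t - \<phi>) = cos (t0 - \<phi>)" using t0 by simp
    then obtain i :: int where "t - \<phi> = t0 - \<phi> + 2 * of_int i * pi \<or> t - \<phi> = - (t0 - \<phi>) + 2 * of_int i * pi"
      unfolding cos_eq by (auto elim!: Ints_cases)
    then have "t = t0 + 2 * of_int i * pi \<or> t = 2 * \<phi> - t0 + 2 * of_int i * pi" by linarith
    then show "t \<in> range (\<lambda>i::int. t0 + 2 * of_int i * pi) \<union> range (\<lambda>i::int. 2 * \<phi> - t0 + 2 * of_int i * pi)" by blast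
  qed
  then show ?thesis by (rule countable_subset) auto
qed auto

text \<open>The Chebyshev argument \<open>u\<close> never exceeds 1. Modulus at least 1 therefore
  needs \<open>u \<le> -1\<close>, which confines \<open>t\<close> to an arc, or an extremal point
  of the Chebyshev polynomial, which leaves countably many \<open>t\<close>.\<close>

lemma mu_f_nk_le:
  assumes n: "n \<ge> 1" and y: "y > 1" and k: "k < 2 * n"
  shows "mu (f_nk n y k) \<le> 2 * pi - 4 * arcsin (critical_sine n y)"
proof -
  note cs = critical_sine[OF n y]
  define Y where "Y = y powr (1 / real n)"
  define \<phi> where "\<phi> = pi * real k / real n"
  \<comment> \<open>The distance from \<open>\<phi>\<close> at which \<open>u\<close> falls to -1,
    since \<open>cos \<delta> = 1 - 2 / Y\<close>.\<close>
  define \<delta> where "\<delta> = 2 * arcsin (critical_sine n y)"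
  have Y: "Y > 0" using y by (simp add: Y_def)
  have \<phi>: "0 \<le> \<phi>" "\<phi> < 2 * pi" using k n by (auto simp: \<phi>_def field_simps simp flip: of_nat_mult of_nat_less_iff)
  have ar: "0 < arcsin (critical_sine n y)" "arcsin (critical_sine n y) < pi / 2"
    using cs(1,2) arcsin_less_arcsin[of 0 "critical_sine n y"] arcsin_less_arcsin[of "critical_sine n y" 1] by auto
  then have \<delta>: "0 < \<delta>" "\<delta> < pi" by (auto simp: \<delta>_def)
  have cos\<delta>: "cos \<delta> = 1 - 2 / Y"
    unfolding \<delta>_def cos_double_sin using cs by (simp add: Y_def)
  define D where "D = (\<Union>i::int. {t. cos (t - \<phi>) = (cos (of_int i * pi / real n) - 1) / Y + 1})"
  have "countable D" unfolding D_def by (intro countable_UN countable_cos_eq) auto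
  then have D: "D \<in> null_sets lborel" by (rule countable_imp_null_set_lborel)
  \<comment> \<open>The parts of the arc to the right and to the left of \<open>\<phi>\<close>, cut
    to one period; either may be empty, yet the lengths add up to
    \<open>2 * pi - 2 * \<delta>\<close>.\<close>
  define A1 where "A1 = {\<phi> + \<delta>..min (2 * pi) (\<phi> + 2 * pi - \<delta>)}"
  define A2 where "A2 = {max 0 (\<phi> - 2 * pi + \<delta>)..\<phi> - \<delta>}"
  have sub: "{t \<in> {0..<2*pi}. \<bar>f_nk n y k t\<bar> \<ge> 1} \<subseteq> (A1 \<union> A2) \<union> D"
  proof
    fix t assume "t \<in> {t \<in> {0..<2*pi}. \<bar>f_nk n y k t\<bar> \<ge> 1}"
    then have t: "0 \<le> t" "t < 2 * pi" "\<bar>f_nk n y k t\<bar> \<ge> 1" by auto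
    define u where "u = Y * cos (t - \<phi>) - Y + 1"
    have T: "\<bar>cheb_T n u\<bar> \<ge> 1" using t(3) by (simp add: f_nk_def u_def Y_def \<phi>_def abs_mult power_abs)
    have u1: "u \<le> 1" using Y by (simp add: u_def)
    show "t \<in> (A1 \<union> A2) \<union> D"
    proof (cases "u \<le> - 1")
      case True
      then have "cos (t - \<phi>) \<le> cos \<delta>" using Y by (simp add: cos\<delta> u_def field_simps)
      moreover have "\<bar>t - \<phi>\<bar> < 2 * pi" using t \<phi> by auto
      ultimately have "\<delta> \<le> \<bar>t - \<phi>\<bar>" "\<bar>t - \<phi>\<bar> \<le> 2 * pi - \<delta>" using cos_le_imp_distance[OF \<delta>] by blast+
      then have "t \<in> A1 \<union> A2" using t by (auto simp: A1_def A2_def abs_if split: if_splits)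
      then show ?thesis by blast
    next
      case False
      define b where "b = arccos u"
      have b: "cos b = u" using False u1 by (simp add: b_def)
      have "\<bar>cos (real n * b)\<bar> \<ge> 1" using T by (simp add: b[symmetric] cheb_T_cos)
      then have "(cos (real n * b))\<^sup>2 \<ge> 1" using abs_le_square_iff[of 1 "cos (real n * b)"] by simp
      then have "(sin (real n * b))\<^sup>2 \<le> 0" using sin_cos_squared_add[of "real n * b"] by linarith
      then have "sin (real n * b) = 0" by simp
      then obtain i :: int where "real n * b = of_int i * pi" using sin_zero_iff_int2 by blast
      then have "b = of_int i * pi / real n" using n by (simp add: field_simps)
      then have "cos (t - \<phi>) = (cos (of_int i * pi / real n) - 1) / Y + 1"
        using b Y by (simp add: u_def field_simps)
      then show ?thesis by (auto simp: D_def)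
    qed
  qed
  have "mu (f_nk n y k) \<le> measure lborel ((A1 \<union> A2) \<union> D)"
    unfolding mu_def
  proof (rule measure_mono_fmeasurable[OF sub])
    show "{t \<in> {0..<2*pi}. \<bar>f_nk n y k t\<bar> \<ge> 1} \<in> sets lborel"
      by (rule measurable_level_set[OF Fny_continuous[OF f_nk_in_Fny[OF n y]]])
    show "(A1 \<union> A2) \<union> D \<in> fmeasurable lborel"
      using D by (intro fmeasurable.Un fmeasurableI_null_sets[OF D]) (auto simp: A1_def A2_def intro: fmeasurable_compact)
  qed
  also have "\<dots> = measure lborel (A1 \<union> A2)"
    using D by (intro measure_Un_null_set) (auto simp: A1_def A2_def)
  also have "\<dots> \<le> measure lborel A1 + measure lborel A2"
    by (intro measure_Un_le) (auto simp: A1_def A2_def)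
  also have "\<dots> \<le> 2 * pi - 2 * \<delta>"
  proof -
    have "measure lborel {a..b} = max 0 (b - a)" for a b :: real by (cases "a \<le> b") auto
    then show ?thesis using \<phi> \<delta> unfolding A1_def A2_def by (simp add: min_def max_def)
  qed
  finally show ?thesis by (simp add: \<delta>_def)
qed

text \<open>The alternating sum forces the leading coefficient to be \<open>y\<close> exactly, that
  is, \<open>cos (real n * \<theta>) = e\<close>; this restricts \<open>\<theta>\<close> to
  multiples of \<open>pi / n\<close>.\<close>

lemma translate_in_Fny:
  assumes n: "n \<ge> 1" and y: "y > 1" and e: "e = 1 \<or> e = - 1"
    and f: "f \<in> Fny n y"
    and f_eq: "f = (\<lambda>t. e * cheb_T n (y powr (1 / real n) * cos (t + \<theta>) - y powr (1 / real n) + 1))"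
  shows "\<exists>k<2*n. f = f_nk n y k"
proof -
  define Y where "Y = y powr (1 / real n)"
  obtain m where m: "n = Suc m" using n by (cases n) auto
  obtain g where g: "trig_poly m g" "\<And>t. cheb_T (Suc m) (Y * cos t + (1 - Y)) = Y ^ Suc m * cos (real (Suc m) * t) + g t"
    using cheb_T_trig_poly by blast
  have Yn: "Y ^ Suc m = y" using leading_coefficient_nth_root[OF n y] by (simp add: Y_def m)
  have f': "f t = e * y * cos (real n * (t + \<theta>)) + e * g (t + \<theta>)" for t
  proof -
    have "f t = e * cheb_T (Suc m) (Y * cos (t + \<theta>) + (1 - Y))"
      by (simp add: f_eq Y_def m algebra_simps)
    also have "\<dots> = e * (y * cos (real n * (t + \<theta>)) + g (t + \<theta>))" unfolding g(2) Yn by (simp only: m)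
    finally show ?thesis by (simp add: algebra_simps)
  qed
  have tp: "trig_poly (n - 1) (\<lambda>t. e * g (t + \<theta>))"
    using trig_poly_scale[OF trig_poly_shift[OF g(1)]] by (simp add: m)
  have "(-1) ^ j * cos (real n * (pi * real j / real n + \<theta>)) = cos (real n * \<theta>)" for j
  proof -
    have "cos (real n * (pi * real j / real n + \<theta>)) = cos (real j * pi + real n * \<theta>)"
      using n by (simp add: distrib_left mult.commute)
    also have "\<dots> = (-1) ^ j * cos (real n * \<theta>)" by (simp add: cos_add)
    finally show ?thesis by (simp flip: mult.assoc power_mult_distrib)
  qed
  then have "(-1) ^ j * f (pi * real j / real n) = e * y * cos (real n * \<theta>) + (-1) ^ j * (e * g (pi * real j / real n + \<theta>))" for j
    unfolding f' by (simp add: distrib_left mult.left_commute[of "(-1) ^ j"])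
  then have "(\<Sum>j<2*n. (-1) ^ j * f (pi * real j / real n)) = 2 * real n * (e * y * cos (real n * \<theta>))"
    using trig_poly_alternating_sum[OF n tp] by (simp add: sum.distrib)
  then have "e * cos (real n * \<theta>) = 1"
    using Fny_alternating_sum[OF n f] n y by simp
  then have ec: "cos (real n * \<theta>) = e" using e by auto
  then have "(sin (real n * \<theta>))\<^sup>2 = 0" using sin_cos_squared_add[of "real n * \<theta>"] e by auto
  then obtain i :: int where i: "real n * \<theta> = of_int i * pi" using sin_zero_iff_int2 by auto
  then have \<theta>: "\<theta> = of_int i * pi / real n" using n by (simp add: field_simps)
  \<comment> \<open>The sign is reversed because \<open>f_nk\<close> shifts to the right, and
    \<open>2 * n\<close> steps of \<open>pi / n\<close> make a full period. As \<open>2 * n\<close>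
    is even, \<open>k\<close> keeps the parity of \<open>i\<close> and so matches the sign
    \<open>e\<close>.\<close>
  define k where "k = nat ((- i) mod (2 * int n))"
  have k: "int k = (- i) mod (2 * int n)" using n by (simp add: k_def)
  have "k < 2 * n" using n by (simp add: k_def nat_less_iff)
  define l where "l = (- i) div (2 * int n)"
  have "- i = 2 * int n * l + int k" unfolding k l_def by (rule mult_div_mod_eq[symmetric])
  then have il: "i = - int k - 2 * int n * l" by linarith
  have "e = cos (pi * of_int i)" using ec i by (simp add: mult.commute)
  also have "\<dots> = (if even i then 1 else - 1)" by (rule cos_npi_int)
  also have "\<dots> = (-1) ^ k" by (simp add: il)
  finally have ek: "e = (-1) ^ k" .
  have "cos (t + \<theta>) = cos (t - pi * real k / real n)" for t
  proof -
    have "t + \<theta> = (t - pi * real k / real n) - 2 * pi * of_int l"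
      using n by (simp add: \<theta> il field_simps)
    moreover have "cos (2 * pi * of_int l) = 1" "sin (2 * pi * of_int l) = 0"
      by (simp_all add: cos_int_2pin sin_int_2pin)
    then have "cos (s - 2 * pi * of_int l) = cos s" for s by (simp add: cos_diff)
    ultimately show ?thesis by (simp only:)
  qed
  then have "f = f_nk n y k" unfolding f_eq f_nk_def[abs_def] ek by simp
  with \<open>k < 2 * n\<close> show ?thesis by blast
qed

theorem theorem1:
  fixes n :: nat and y :: real
  assumes "n \<ge> 1" and "y > 1"
  shows "sigma n y = 4 * arccos (1 / y powr (1 / (2 * real n)))
    \<and> (\<forall>k < 2 * n. f_nk n y k \<in> Fny n y \<and> mu (f_nk n y k) = sigma n y)
    \<and> (\<forall>f \<in> Fny n y. mu f = sigma n y \<longrightarrow> (\<exists>k < 2 * n. f = f_nk n y k))"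
proof -
  note cs = critical_sine[OF assms]
  define v where "v = 4 * arccos (1 / y powr (1 / (2 * real n)))"
  have v: "v = 2 * pi - 4 * arcsin (critical_sine n y)"
    unfolding v_def critical_sine_def[symmetric] using cs(1,2) by (simp add: arccos_arcsin_eq)
  have lower: "v \<le> mu f" if "f \<in> Fny n y" for f
    using sum_measure_level_sets_ge[OF Fny_continuous[OF that]] Fny_measure_bound(1)[OF assms that]
    by (simp add: v)
  have attained: "mu (f_nk n y k) = v" if "k < 2 * n" for k
    using lower[OF f_nk_in_Fny[OF assms]] mu_f_nk_le[OF assms that] by (simp add: v order_antisym)
  have sigma: "sigma n y = v" unfolding sigma_def
  proof (rule cInf_eq_minimum)
    show "v \<in> mu ` Fny n y"
      using attained[of 0] f_nk_in_Fny[OF assms, of 0] assms(1) by (intro image_eqI[of _ _ "f_nk n y 0"]) auto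
  qed (use lower in auto)
  moreover have "\<exists>k<2*n. f = f_nk n y k" if f: "f \<in> Fny n y" "mu f = v" for f
  proof -
    \<comment> \<open>Minimality of \<open>mu f\<close> and the covering inequality bound the
      measure from below by the value that already bounds it from above.\<close>
    have "measure lborel {t \<in> {0..2*pi}. \<bar>f t\<bar> \<le> 1} = 4 * arcsin (critical_sine n y)"
      using sum_measure_level_sets_ge[OF Fny_continuous[OF f(1)]] Fny_measure_bound(1)[OF assms f(1)] f(2)
      by (simp add: v)
    from Fny_measure_bound(2)[OF assms f(1) this] show ?thesis
      using translate_in_Fny[OF assms _ f(1)] by blast
  qed
  ultimately show ?thesis using attained f_nk_in_Fny[OF assms] unfolding v_def by auto
qed

end
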